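(* Let $K$ be a field, $Q$ a connected quiver and $\alpha$ a dimension vector for $Q$. For any nonnegative integer $n$, the locus $$R_n := \{\phi \in \operatorname{rep}(Q,\alpha) \mid \operatorname{rank}_Q(\phi) = n\}$$ is constructible in $\operatorname{rep}(Q,\alpha)$. Thus, any rank locus in $\operatorname{rep}(Q,\alpha)$ is constructible.
   Context: $K$ is an arbitrary field. A quiver is a finite directed graph (loops and parallel arrows allowed); all quivers are assumed connected. For an arrow $a$, $ta$ and $ha$ denote its tail and head. A representation $\phi=(V_x,\phi_a)$ of $Q$ assigns a finite-dimensional $K$-vector space $V_x$ to each vertex $x$ and a linear map $\phi_a\colon V_{ta}\to V_{ha}$ to each arrow $a$; with the usual morphisms these form a category $\operatorname{rep}(Q)$. A dimension vector $\alpha$ assigns a nonnegative integer $\alpha(x)$ to each vertex $x$. The representation space is the affine space $\operatorname{rep}(Q,\alpha)=\bigoplus_{a}\operatorname{Hom}_K(K^{\alpha(ta)},K^{\alpha(ha)})$ (sum over arrows), with the Zariski topology; a point $\phi=(\phi_a)$ is identified with the representation having spaces $K^{\alpha(x)}$ and maps $\phi_a$. A subset of a variety is constructible if it can be obtained from finitely many subsets, each open or closed, via unions and intersections. Global rank function: a representation $\phi$ has a unique largest subrepresentation $\mathcal{E}(\phi)$ in which the map over every arrow is surjective, and a unique largest quotient representation $\mathcal{M}(\phi)$ in which the map over every arrow is injective. The image of the composition $\mathcal{E}(\phi)\hookrightarrow\phi\twoheadrightarrow\mathcal{M}(\phi)$ has an isomorphism over every arrow, so (as $Q$ is connected) its vector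 spaces at all vertices have a common dimension; this number is $\operatorname{rank}_Q(\phi)$. Rank functions: a morphism of quivers $f\colon Q'\to Q$ sends vertices to vertices and arrows to arrows compatibly with heads and tails. It induces a pullback $f^*\colon\operatorname{rep}(Q)\to\operatorname{rep}(Q')$, $f^*(W_x,\psi_a)=(W_{f(x)},\psi_{f(a)})$, and a pushforward $f_*\colon\operatorname{rep}(Q')\to\operatorname{rep}(Q)$, $f_*(V_x,\phi_a)=\left(\bigoplus_{y\in f^{-1}(x)}V_y,\ \sum_{b\in f^{-1}(a)}\phi_b\right)$, where each $\phi_b$ is extended by zero to the summands $V_y$ with $y\neq tb$. A rank function on $Q$ is any function $\operatorname{rep}(Q)\to\mathbb{Z}_{\ge 0}$ of the form $\phi\mapsto \operatorname{rank}_{Q_m}(F_{m-1}\cdots F_1\phi)$, where $Q=Q_1,Q_2,\dots,Q_m$ is a finite sequence of quivers and each $F_i\colon\operatorname{rep}(Q_i)\to\operatorname{rep}(Q_{i+1})$ is either the pushforward along a morphism $Q_i\to Q_{i+1}$ or the pullback along a morphism $Q_{i+1}\to Q_i$. A rank locus in $\operatorname{rep}(Q,\alpha)$ is the set of points satisfying some finite list of linear inequalities in the values of rank functions on $Q$. *)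

theory Defs
  imports
    "HOL-Analysis.Abstract_Topology"
    "HOL-Library.Function_Algebras"
    "HOL-Library.Countable_Set"
    "HOL-Library.Nat_Bijection"
    "HOL-Library.FuncSet"
    "Graph_Theory.Digraph_Component"
    "Jordan_Normal_Form.Matrix"
begin

section \<open>Quivers\<close>

text \<open>The constant \<open>Digraph_Component.connected\<close> is connectedness of the underlying undirected
  graph (and includes that there is a vertex); loops and parallel arrows are allowed.\<close>

definition quiver :: "('v,'e) pre_digraph \<Rightarrow> bool" where
  "quiver Q \<longleftrightarrow> fin_digraph Q \<and> Digraph_Component.connected Q"

definition quiver_hom ::
  "('v,'e) pre_digraph \<Rightarrow> ('w,'d) pre_digraph \<Rightarrow> ('v \<Rightarrow> 'w) \<times> ('e \<Rightarrow> 'd) \<Rightarrow> bool" where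
  "quiver_hom Q Q' f \<longleftrightarrow>
     (\<forall>x\<in>verts Q. fst f x \<in> verts Q') \<and>
     (\<forall>a\<in>arcs Q. snd f a \<in> arcs Q' \<and>
        tail Q' (snd f a) = fst f (tail Q a) \<and> head Q' (snd f a) = fst f (head Q a))"

section \<open>Finite-dimensional vector spaces\<close>

text \<open>Finite-dimensional \<open>K\<close>-vector spaces are realised as finite-dimensional subspaces of the
  space of all sequences in \<open>K\<close>; every one has an isomorphic copy there.  A linear map
  \<open>V \<rightarrow> W\<close> is given by a linear map on the whole ambient space that sends \<open>V\<close> into \<open>W\<close>; every
  linear map between subspaces arises in this way, and only its restriction to \<open>V\<close> matters
  below.\<close>

type_synonym 'k vect = "nat \<Rightarrow> 'k"

definition vscale :: "'k::field \<Rightarrow> 'k vect \<Rightarrow> 'k vect" where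
  "vscale c v = (\<lambda>i. c * v i)"

global_interpretation vect: vector_space "vscale :: 'k::field \<Rightarrow> 'k vect \<Rightarrow> 'k vect"
  by unfold_locales (auto simp: vscale_def fun_eq_iff algebra_simps)

definition fd_subspace :: "'k::field vect set \<Rightarrow> bool" where
  "fd_subspace V \<longleftrightarrow> vect.subspace V \<and> (\<exists>B. finite B \<and> V = vect.span B)"

definition linear_map :: "'k::field vect set \<Rightarrow> 'k vect set \<Rightarrow> ('k vect \<Rightarrow> 'k vect) \<Rightarrow> bool" where
  "linear_map V W f \<longleftrightarrow> Vector_Spaces.linear vscale vscale f \<and> f ` V \<subseteq> W"

section \<open>Representations\<close>

record ('v,'e,'k) representation =
  vsp :: "'v \<Rightarrow> 'k vect set"
  amap :: "'e \<Rightarrow> 'k vect \<Rightarrow> 'k vect"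

definition rep :: "('v,'e) pre_digraph \<Rightarrow> ('v,'e,'k::field) representation set" where
  "rep Q = {\<phi>. (\<forall>x\<in>verts Q. fd_subspace (vsp \<phi> x)) \<and>
     (\<forall>a\<in>arcs Q. linear_map (vsp \<phi> (tail Q a)) (vsp \<phi> (head Q a)) (amap \<phi> a))}"

definition rep_hom ::
  "('v,'e) pre_digraph \<Rightarrow> ('v,'e,'k::field) representation \<Rightarrow> ('v,'e,'k) representation \<Rightarrow>
   ('v \<Rightarrow> 'k vect \<Rightarrow> 'k vect) \<Rightarrow> bool" where
  "rep_hom Q \<phi> \<psi> h \<longleftrightarrow>
     (\<forall>x\<in>verts Q. linear_map (vsp \<phi> x) (vsp \<psi> x) (h x)) \<and>
     (\<forall>a\<in>arcs Q. \<forall>v\<in>vsp \<phi> (tail Q a).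
        h (head Q a) (amap \<phi> a v) = amap \<psi> a (h (tail Q a) v))"

definition subrep ::
  "('v,'e) pre_digraph \<Rightarrow> ('v,'e,'k::field) representation \<Rightarrow> ('v,'e,'k) representation \<Rightarrow> bool" where
  "subrep Q \<phi> \<psi> \<longleftrightarrow> \<psi> \<in> rep Q \<and>
     (\<forall>x\<in>verts Q. vsp \<psi> x \<subseteq> vsp \<phi> x) \<and>
     (\<forall>a\<in>arcs Q. \<forall>v\<in>vsp \<psi> (tail Q a). amap \<psi> a v = amap \<phi> a v)"

text \<open>A quotient of \<open>\<phi>\<close> is a representation \<open>\<psi>\<close> together with an epimorphism \<open>p\<close> from \<open>\<phi>\<close>
  to \<open>\<psi>\<close>.\<close>

definition quotient_rep ::
  "('v,'e) pre_digraph \<Rightarrow> ('v,'e,'k::field) representation \<Rightarrow> ('v,'e,'k) representation \<Rightarrow>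
   ('v \<Rightarrow> 'k vect \<Rightarrow> 'k vect) \<Rightarrow> bool" where
  "quotient_rep Q \<phi> \<psi> p \<longleftrightarrow>
     \<psi> \<in> rep Q \<and> rep_hom Q \<phi> \<psi> p \<and> (\<forall>x\<in>verts Q. p x ` vsp \<phi> x = vsp \<psi> x)"

definition all_surj :: "('v,'e) pre_digraph \<Rightarrow> ('v,'e,'k::field) representation \<Rightarrow> bool" where
  "all_surj Q \<psi> \<longleftrightarrow> (\<forall>a\<in>arcs Q. amap \<psi> a ` vsp \<psi> (tail Q a) = vsp \<psi> (head Q a))"

definition all_inj :: "('v,'e) pre_digraph \<Rightarrow> ('v,'e,'k::field) representation \<Rightarrow> bool" where
  "all_inj Q \<psi> \<longleftrightarrow> (\<forall>a\<in>arcs Q. inj_on (amap \<psi> a) (vsp \<psi> (tail Q a)))"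

section \<open>The global rank\<close>

definition largest_surj_subrep ::
  "('v,'e) pre_digraph \<Rightarrow> ('v,'e,'k::field) representation \<Rightarrow> ('v,'e,'k) representation \<Rightarrow> bool" where
  "largest_surj_subrep Q \<phi> E \<longleftrightarrow> subrep Q \<phi> E \<and> all_surj Q E \<and>
     (\<forall>E'. subrep Q \<phi> E' \<and> all_surj Q E' \<longrightarrow> subrep Q E E')"

text \<open>Quotients are ordered by factorisation: the largest one is the one through which the
  others factor.\<close>

definition largest_inj_quotient ::
  "('v,'e) pre_digraph \<Rightarrow> ('v,'e,'k::field) representation \<Rightarrow> ('v,'e,'k) representation \<Rightarrow>
   ('v \<Rightarrow> 'k vect \<Rightarrow> 'k vect) \<Rightarrow> bool" where
  "largest_inj_quotient Q \<phi> M p \<longleftrightarrow> quotient_rep Q \<phi> M p \<and> all_inj Q M \<and>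
     (\<forall>M' p'. quotient_rep Q \<phi> M' p' \<and> all_inj Q M' \<longrightarrow>
        (\<exists>h. rep_hom Q M M' h \<and> (\<forall>x\<in>verts Q. \<forall>v\<in>vsp \<phi> x. p' x v = h x (p x v))))"

definition global_rank :: "('v,'e) pre_digraph \<Rightarrow> ('v,'e,'k::field) representation \<Rightarrow> nat" where
  "global_rank Q \<phi> = (THE n. \<exists>E M p. largest_surj_subrep Q \<phi> E \<and> largest_inj_quotient Q \<phi> M p \<and>
     (\<forall>x\<in>verts Q. vect.dim (p x ` vsp E x) = n))"

section \<open>Pullback, pushforward and rank functions\<close>

definition pullback ::
  "('v \<Rightarrow> 'w) \<times> ('e \<Rightarrow> 'd) \<Rightarrow> ('w,'d,'k::field) representation \<Rightarrow> ('v,'e,'k) representation" where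
  "pullback f \<psi> = \<lparr>vsp = (\<lambda>x. vsp \<psi> (fst f x)), amap = (\<lambda>a. amap \<psi> (snd f a))\<rparr>"

text \<open>The ambient space splits into countably many copies of itself along the pairing
  \<open>prod_encode\<close>; one copy is reserved for each vertex of \<open>Q\<close>.  The maps \<open>incl Q y\<close> and
  \<open>proj Q y\<close> are the inclusion of and the projection onto the copy for the vertex \<open>y\<close>, so that
  the sum of the images of the \<open>incl Q y\<close> is the direct sum over the vertices.\<close>

definition incl :: "('v,'e) pre_digraph \<Rightarrow> 'v \<Rightarrow> 'k::field vect \<Rightarrow> 'k vect" where
  "incl Q y v = (\<lambda>j. case prod_decode j of (m, i) \<Rightarrow> if m = to_nat_on (verts Q) y then v i else 0)"

definition proj :: "('v,'e) pre_digraph \<Rightarrow> 'v \<Rightarrow> 'k::field vect \<Rightarrow> 'k vect" where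
  "proj Q y u = (\<lambda>i. u (prod_encode (to_nat_on (verts Q) y, i)))"

lemma proj_incl:
  assumes "quiver Q" "y \<in> verts Q" "z \<in> verts Q"
  shows "proj Q y (incl Q z v) = (if y = z then v else 0)"
proof -
  have "countable (verts Q)"
    using assms(1) by (simp add: quiver_def fin_digraph.finite_verts countable_finite)
  then show ?thesis
    using assms(2,3) by (auto simp: proj_def incl_def fun_eq_iff)
qed

definition pushforward ::
  "('v,'e) pre_digraph \<Rightarrow> ('v \<Rightarrow> 'w) \<times> ('e \<Rightarrow> 'd) \<Rightarrow>
   ('v,'e,'k::field) representation \<Rightarrow> ('w,'d,'k) representation" where
  "pushforward Q f \<phi> =
     \<lparr>vsp = (\<lambda>x. {(\<Sum>y | y \<in> verts Q \<and> fst f y = x. incl Q y (v y)) | v.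
                   \<forall>y\<in>verts Q. v y \<in> vsp \<phi> y}),
      amap = (\<lambda>a u. \<Sum>b | b \<in> arcs Q \<and> snd f b = a.
                   incl Q (head Q b) (amap \<phi> b (proj Q (tail Q b) u)))\<rparr>"

definition elementary_functor ::
  "('v,'e) pre_digraph \<Rightarrow> ('w,'d) pre_digraph \<Rightarrow>
   (('v,'e,'k::field) representation \<Rightarrow> ('w,'d,'k) representation) \<Rightarrow> bool" where
  "elementary_functor Q Q' F \<longleftrightarrow>
     (\<exists>f. quiver_hom Q Q' f \<and> F = pushforward Q f) \<or>
     (\<exists>f. quiver_hom Q' Q f \<and> F = pullback f)"

text \<open>The quivers in the sequence following \<open>Q\<close> may be taken to have natural numbers as vertices
  and arrows, since every finite quiver is isomorphic to such a quiver.  The separate treatment of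
  the first step allows \<open>Q\<close> itself to have vertices and arrows of arbitrary type.\<close>

inductive nat_rank_function ::
  "(nat,nat) pre_digraph \<Rightarrow> ((nat,nat,'k::field) representation \<Rightarrow> nat) \<Rightarrow> bool" where
  global: "quiver Q \<Longrightarrow> nat_rank_function Q (global_rank Q)"
| step: "quiver Q \<Longrightarrow> quiver Q' \<Longrightarrow> elementary_functor Q Q' F \<Longrightarrow> nat_rank_function Q' r \<Longrightarrow>
    nat_rank_function Q (\<lambda>\<phi>. r (F \<phi>))"

definition rank_function ::
  "('v,'e) pre_digraph \<Rightarrow> (('v,'e,'k::field) representation \<Rightarrow> nat) \<Rightarrow> bool" where
  "rank_function Q r \<longleftrightarrow> quiver Q \<and>
     (r = global_rank Q \<or>
      (\<exists>Q' F r'. quiver Q' \<and> elementary_functor Q Q' F \<and> nat_rank_function Q' r' \<and>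
         r = (\<lambda>\<phi>. r' (F \<phi>))))"

lemma rank_function_nat: "rank_function Q r \<longleftrightarrow> nat_rank_function Q r"
proof
  assume "rank_function Q r"
  then show "nat_rank_function Q r"
    unfolding rank_function_def
    by (elim conjE disjE exE) (simp_all add: nat_rank_function.global nat_rank_function.step)
next
  assume "nat_rank_function Q r"
  then show "rank_function Q r"
    by cases (unfold rank_function_def, blast+)
qed

section \<open>The representation space\<close>

definition rep_space :: "('v,'e) pre_digraph \<Rightarrow> ('v \<Rightarrow> nat) \<Rightarrow> ('e \<Rightarrow> 'k::field mat) set" where
  "rep_space Q \<alpha> = (\<Pi>\<^sub>E a\<in>arcs Q. carrier_mat (\<alpha> (head Q a)) (\<alpha> (tail Q a)))"

text \<open>The space \<open>K\<^sup>n\<close> is the space of sequences vanishing from index \<open>n\<close> on.\<close>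

definition rep_of :: "('v \<Rightarrow> nat) \<Rightarrow> ('e \<Rightarrow> 'k::field mat) \<Rightarrow> ('v,'e,'k) representation" where
  "rep_of \<alpha> A =
     \<lparr>vsp = (\<lambda>x. {v. \<forall>i\<ge>\<alpha> x. v i = 0}),
      amap = (\<lambda>a v i. if i < dim_row (A a) then (A a *\<^sub>v vec (dim_col (A a)) v) $ i else 0)\<rparr>"

inductive_set poly_funs ::
  "('v,'e) pre_digraph \<Rightarrow> ('v \<Rightarrow> nat) \<Rightarrow> (('e \<Rightarrow> 'k::field mat) \<Rightarrow> 'k) set"
  for Q :: "('v,'e) pre_digraph" and \<alpha> :: "'v \<Rightarrow> nat" where
  const: "(\<lambda>A. c) \<in> poly_funs Q \<alpha>"
| coord: "a \<in> arcs Q \<Longrightarrow> i < \<alpha> (head Q a) \<Longrightarrow> j < \<alpha> (tail Q a) \<Longrightarrow>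
    (\<lambda>A. A a $$ (i, j)) \<in> poly_funs Q \<alpha>"
| add: "f \<in> poly_funs Q \<alpha> \<Longrightarrow> g \<in> poly_funs Q \<alpha> \<Longrightarrow> (\<lambda>A. f A + g A) \<in> poly_funs Q \<alpha>"
| mult: "f \<in> poly_funs Q \<alpha> \<Longrightarrow> g \<in> poly_funs Q \<alpha> \<Longrightarrow> (\<lambda>A. f A * g A) \<in> poly_funs Q \<alpha>"

definition zero_locus ::
  "('v,'e) pre_digraph \<Rightarrow> ('v \<Rightarrow> nat) \<Rightarrow> (('e \<Rightarrow> 'k::field mat) \<Rightarrow> 'k) set \<Rightarrow> ('e \<Rightarrow> 'k mat) set" where
  "zero_locus Q \<alpha> F = {A \<in> rep_space Q \<alpha>. \<forall>f\<in>F. f A = 0}"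

definition zariski :: "('v,'e) pre_digraph \<Rightarrow> ('v \<Rightarrow> nat) \<Rightarrow> ('e \<Rightarrow> 'k::field mat) topology" where
  "zariski Q \<alpha> = topology (\<lambda>U. \<exists>F\<subseteq>poly_funs Q \<alpha>. U = rep_space Q \<alpha> - zero_locus Q \<alpha> F)"

lemma istopology_zariski:
  "istopology (\<lambda>U. \<exists>F\<subseteq>poly_funs Q \<alpha>. U = rep_space Q \<alpha> - zero_locus Q \<alpha> F)"
  unfolding istopology_def
proof (intro conjI allI impI)
  fix S T :: "('a \<Rightarrow> 'b mat) set"
  assume "\<exists>F\<subseteq>poly_funs Q \<alpha>. S = rep_space Q \<alpha> - zero_locus Q \<alpha> F"
    and "\<exists>F\<subseteq>poly_funs Q \<alpha>. T = rep_space Q \<alpha> - zero_locus Q \<alpha> F"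
  then obtain F G where F: "F \<subseteq> poly_funs Q \<alpha>" "S = rep_space Q \<alpha> - zero_locus Q \<alpha> F"
    and G: "G \<subseteq> poly_funs Q \<alpha>" "T = rep_space Q \<alpha> - zero_locus Q \<alpha> G" by blast
  define H where "H = (\<lambda>(f, g) A. f A * g A) ` (F \<times> G)"
  have "H \<subseteq> poly_funs Q \<alpha>"
    using F(1) G(1) by (auto simp: H_def intro!: poly_funs.mult)
  moreover have "(\<forall>h\<in>H. h A = 0) \<longleftrightarrow> (\<forall>f\<in>F. \<forall>g\<in>G. f A = 0 \<or> g A = 0)" for A
    by (simp add: H_def)
  then have "S \<inter> T = rep_space Q \<alpha> - zero_locus Q \<alpha> H"
    unfolding F(2) G(2) zero_locus_def by auto
  ultimately show "\<exists>F\<subseteq>poly_funs Q \<alpha>. S \<inter> T = rep_space Q \<alpha> - zero_locus Q \<alpha> F" by blast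
next
  fix \<K> :: "('a \<Rightarrow> 'b mat) set set"
  assume "\<forall>U\<in>\<K>. \<exists>F\<subseteq>poly_funs Q \<alpha>. U = rep_space Q \<alpha> - zero_locus Q \<alpha> F"
  then obtain F where F: "\<And>U. U \<in> \<K> \<Longrightarrow> F U \<subseteq> poly_funs Q \<alpha>"
    "\<And>U. U \<in> \<K> \<Longrightarrow> U = rep_space Q \<alpha> - zero_locus Q \<alpha> (F U)" by metis
  have "\<Union>\<K> = (\<Union>U\<in>\<K>. rep_space Q \<alpha> - zero_locus Q \<alpha> (F U))"
    using F(2) by (simp cong: SUP_cong)
  also have "\<dots> = rep_space Q \<alpha> - zero_locus Q \<alpha> (\<Union>U\<in>\<K>. F U)"
    by (auto simp: zero_locus_def)
  finally have "\<Union>\<K> = rep_space Q \<alpha> - zero_locus Q \<alpha> (\<Union>U\<in>\<K>. F U)" .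
  moreover have "(\<Union>U\<in>\<K>. F U) \<subseteq> poly_funs Q \<alpha>"
    by (rule UN_least) (rule F(1))
  ultimately show "\<exists>F\<subseteq>poly_funs Q \<alpha>. \<Union>\<K> = rep_space Q \<alpha> - zero_locus Q \<alpha> F"
    by (intro exI conjI)
qed

lemma openin_zariski:
  "openin (zariski Q \<alpha>) U \<longleftrightarrow> (\<exists>F\<subseteq>poly_funs Q \<alpha>. U = rep_space Q \<alpha> - zero_locus Q \<alpha> F)"
  unfolding zariski_def topology_inverse'[OF istopology_zariski] ..

lemma topspace_zariski:
  fixes Q :: "('v,'e) pre_digraph"
  shows "topspace (zariski Q \<alpha>) = (rep_space Q \<alpha> :: ('e \<Rightarrow> 'k::field mat) set)" (is "_ = ?R")
proof (rule subset_antisym)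
  have "\<exists>F\<subseteq>poly_funs Q \<alpha>. topspace (zariski Q \<alpha>) = ?R - zero_locus Q \<alpha> F"
    unfolding openin_zariski[symmetric] by (rule openin_topspace)
  then show "topspace (zariski Q \<alpha>) \<subseteq> ?R"
    by (elim exE conjE) simp
  have "{\<lambda>A. 1} \<subseteq> poly_funs Q \<alpha>" by (simp add: poly_funs.const)
  moreover have "?R = ?R - zero_locus Q \<alpha> {\<lambda>A. 1}"
    by (simp add: zero_locus_def)
  ultimately have "openin (zariski Q \<alpha>) ?R"
    unfolding openin_zariski by blast
  then show "?R \<subseteq> topspace (zariski Q \<alpha>)" by (rule openin_subset)
qed

lemma closedin_zariski:
  "closedin (zariski Q \<alpha>) S \<longleftrightarrow> (\<exists>F\<subseteq>poly_funs Q \<alpha>. S = zero_locus Q \<alpha> F)"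
proof -
  have "S \<subseteq> rep_space Q \<alpha> \<and> rep_space Q \<alpha> - S = rep_space Q \<alpha> - zero_locus Q \<alpha> F \<longleftrightarrow>
      S = zero_locus Q \<alpha> F" for F
    unfolding zero_locus_def by blast
  then show ?thesis
    unfolding closedin_def topspace_zariski openin_zariski by blast
qed

inductive constructible :: "'a topology \<Rightarrow> 'a set \<Rightarrow> bool" for X :: "'a topology" where
  openin: "openin X S \<Longrightarrow> constructible X S"
| closedin: "closedin X S \<Longrightarrow> constructible X S"
| Un: "constructible X S \<Longrightarrow> constructible X T \<Longrightarrow> constructible X (S \<union> T)"
| Int: "constructible X S \<Longrightarrow> constructible X T \<Longrightarrow> constructible X (S \<inter> T)"

section \<open>Rank loci\<close>

text \<open>The locus of one (strict or non-strict) linear inequality, with real coefficients, between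
  values of rank functions.\<close>

definition linear_rank_locus ::
  "('v,'e) pre_digraph \<Rightarrow> ('v \<Rightarrow> nat) \<Rightarrow> ('e \<Rightarrow> 'k::field mat) set \<Rightarrow> bool" where
  "linear_rank_locus Q \<alpha> S \<longleftrightarrow>
     (\<exists>cs :: (real \<times> (('v,'e,'k) representation \<Rightarrow> nat)) list. \<exists>b :: real.
        (\<forall>(c, r)\<in>set cs. rank_function Q r) \<and>
        (S = {A \<in> rep_space Q \<alpha>. (\<Sum>(c, r)\<leftarrow>cs. c * real (r (rep_of \<alpha> A))) \<le> b} \<or>
         S = {A \<in> rep_space Q \<alpha>. (\<Sum>(c, r)\<leftarrow>cs. c * real (r (rep_of \<alpha> A))) < b}))"

definition rank_locus ::
  "('v,'e) pre_digraph \<Rightarrow> ('v \<Rightarrow> nat) \<Rightarrow> ('e \<Rightarrow> 'k::field mat) set \<Rightarrow> bool" where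
  "rank_locus Q \<alpha> R \<longleftrightarrow>
     (\<exists>Ss. finite Ss \<and> (\<forall>S\<in>Ss. linear_rank_locus Q \<alpha> S) \<and> R = rep_space Q \<alpha> \<inter> \<Inter>Ss)"

end

(* In a family of representations whose maps depend polynomially on a point A, every subspace
   obtained from the given ones by images, preimages, sums and intersections is, after cutting the
   parameter space into finitely many constructible pieces, spanned by vectors with polynomial
   coordinates: fraction-free elimination only branches on whether a polynomial vanishes.  No field
   extension is involved, so this works over an arbitrary field, where projections of constructible
   sets need not be constructible.  The dimension of such a subspace is a constructible function.

   The largest surjective subrepresentation E of phi is the limit of a decreasing sequence of such
   subspaces, and the kernel N of the largest injective quotient is the limit of an increasing one;
   since the dimensions are bounded, both become stationary after a number of steps that does not
   depend on A.  Finally rank(phi) = dim E(x) - dim (E(x) Int N(x)) for every vertex x.  Pullback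
   and pushforward preserve families of this kind, so all rank functions are constructible. *)

theory Submission
  imports Defs
begin

section \<open>Dimensions of finitely spanned subspaces\<close>

text \<open>The definition of the rank quantifies over all subrepresentations and all quotients; a
  bounded iteration of subspace operations replaces these quantifiers. The functors change the
  quiver while the point A stays the same, so the objects of study are families over an abstract
  parameter set \<open>R\<close>, and no map between different representation spaces has to be
  described. All splitting of subspace families comes from one operation, cutting a span by the
  vanishing of one coordinate: a preimage is reduced to it by passing to a graph, and the dimension
  is found by removing one coordinate at a time. Both reductions need finitely many coordinates
  although vectors are infinite sequences; hence every family has a bound on the supports that does
  not depend on A. The definite description in the rank also demands a number that is the same at
  all vertices, which follows from connectedness.\<close>

context vector_space
begin

text \<open>The sequence space is infinite-dimensional, so finiteness of a basis has to come from
  elsewhere: from a finite set \<open>W\<close> whose span contains \<open>V\<close>, and which need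
  not lie in \<open>V\<close>.\<close>

lemma finite_basis_exists:
  assumes "V \<subseteq> span W" "finite W"
  shows "\<exists>B\<subseteq>V. independent B \<and> V \<subseteq> span B \<and> finite B \<and> card B = dim V"
proof -
  obtain B where B: "B \<subseteq> V" "independent B" "V \<subseteq> span B" "card B = dim V"
    using basis_exists by blast
  have "finite B"
    using independent_span_bound[OF assms(2) B(2) subset_trans[OF B(1) assms(1)]] ..
  then show ?thesis using B by blast
qed

lemma subspace_finite_span:
  assumes "subspace V" "V \<subseteq> span W" "finite W"
  shows "\<exists>B. finite B \<and> V = span B"
proof -
  obtain B where "B \<subseteq> V" "V \<subseteq> span B" "finite B"
    using finite_basis_exists[OF assms(2,3)] by blast
  then show ?thesis using span_minimal[OF _ assms(1)] by blast
qed

lemma dim_mono_finite: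
  assumes "V \<subseteq> U" "U \<subseteq> span W" "finite W"
  shows "dim V \<le> dim U"
proof -
  obtain B where B: "independent B" "card B = dim V" "B \<subseteq> V"
    using finite_basis_exists[of V W] assms by blast
  obtain C where C: "U \<subseteq> span C" "finite C" "card C = dim U"
    using finite_basis_exists[OF assms(2,3)] by blast
  show ?thesis
    using independent_span_bound[OF C(2) B(1)] B C assms(1) by auto
qed

lemma subspace_eq_if_dim_le:
  assumes "subspace V" "V \<subseteq> U" "U \<subseteq> span W" "finite W" "dim U \<le> dim V"
  shows "V = U"
proof (rule ccontr)
  assume "V \<noteq> U"
  then obtain u where u: "u \<in> U" "u \<notin> V" using assms(2) by blast
  obtain B where B: "B \<subseteq> V" "independent B" "V \<subseteq> span B" "finite B" "card B = dim V"
    using finite_basis_exists[of V W] assms by blast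
  obtain C where C: "U \<subseteq> span C" "finite C" "card C = dim U"
    using finite_basis_exists[OF assms(3,4)] by blast
  have sp: "span B \<subseteq> V" by (rule span_minimal[OF B(1) assms(1)])
  then have "u \<notin> span B" using u by blast
  then have "independent (insert u B)" "u \<notin> B"
    using B(2) independent_insertI span_base by blast+
  then have "Suc (dim V) \<le> dim U"
    using independent_span_bound[OF C(2), of "insert u B"] B C u assms(2) by auto
  then show False using assms(5) by simp
qed

text \<open>Subtracting a multiple of \<open>v\<close> moves any vector of \<open>S\<close> into the
  kernel, so \<open>v\<close> completes a basis of the kernel to one of \<open>S\<close>. Applied to
  coordinate functionals, this counts dimensions one coordinate at a time.\<close>

lemma dim_kernel_functional:
  assumes S: "subspace S" "S \<subseteq> span W" "finite W"
    and f: "Vector_Spaces.linear scale (*) f" and v: "v \<in> S" "f v \<noteq> 0"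
  shows "dim S = Suc (dim {u \<in> S. f u = 0})"
proof -
  interpret f: Vector_Spaces.linear scale "(*)" f by fact
  let ?K = "{u \<in> S. f u = 0}"
  obtain B where B: "B \<subseteq> ?K" "independent B" "?K \<subseteq> span B" "finite B" "card B = dim ?K"
    using finite_basis_exists[of ?K W] S by blast
  have "subspace ?K"
    using S(1) by (auto simp: subspace_def f.add f.scale f.zero)
  then have "span B \<subseteq> ?K" by (rule span_minimal[OF B(1)])
  then have vB: "v \<notin> span B" using v by blast
  have ind: "independent (insert v B)" "v \<notin> B"
    using B(2) vB independent_insertI span_base by blast+
  have "S \<subseteq> span (insert v B)"
  proof
    fix u assume u: "u \<in> S"
    define c where "c = f u / f v"
    have "u - scale c v \<in> ?K"
      using u v S(1) by (simp add: f.diff f.scale c_def subspace_diff subspace_scale)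
    then have "u - scale c v \<in> span B" using B(3) by blast
    then show "u \<in> span (insert v B)" by (auto simp: span_insert)
  qed
  then have "card (insert v B) = dim S"
    using B(1) v ind by (intro basis_card_eq_dim) auto
  then show ?thesis using B ind by simp
qed

text \<open>The coordinates of \<open>v\<close> in the basis \<open>B\<close> are supported both in
  \<open>C\<close> and in \<open>D\<close>, hence nowhere.\<close>

lemma span_Int_span_eq_0:
  assumes "independent B" "C \<subseteq> B" "D \<subseteq> B" "C \<inter> D = {}" "v \<in> span C" "v \<in> span D"
  shows "v = 0"
proof -
  have "representation B v b = 0" for b
    using representation_extend[OF assms(1,5,2)] representation_extend[OF assms(1,6,3)]
      representation_ne_zero[of C v b] representation_ne_zero[of D v b] assms(4) by fastforce
  moreover have "v \<in> span B" using assms(2,5) span_mono by blast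
  ultimately show ?thesis using sum_nonzero_representation_eq[OF assms(1), of v] by simp
qed

end

section \<open>Rank-nullity on a finitely spanned subspace\<close>

context vector_space_pair
begin

lemma dim_kernel_plus_image:
  assumes S: "vs1.subspace S" "S \<subseteq> vs1.span W" "finite W" and f: "Vector_Spaces.linear s1 s2 f"
  shows "vs1.dim S = vs1.dim {v \<in> S. f v = 0} + vs2.dim (f ` S)"
proof -
  interpret f: Vector_Spaces.linear s1 s2 f by fact
  let ?K = "{u \<in> S. f u = 0}"
  obtain B0 where B0: "B0 \<subseteq> ?K" "vs1.independent B0" "?K \<subseteq> vs1.span B0" "finite B0"
      "card B0 = vs1.dim ?K"
    using vs1.finite_basis_exists[of ?K W] S by blast
  obtain B where B: "B0 \<subseteq> B" "B \<subseteq> S" "vs1.independent B" "S \<subseteq> vs1.span B"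
    using vs1.maximal_independent_subset_extend[of B0 S] B0 by blast
  have fB: "finite B"
    using vs1.independent_span_bound[OF S(3) B(3)] B(2) S(2) by blast
  let ?C = "B - B0"
  have spB: "vs1.span B \<subseteq> S" by (rule vs1.span_minimal[OF B(2) S(1)])
  \<comment> \<open>A difference in the span of \<open>?C\<close> that \<open>f\<close> kills also
    lies in the span of the kernel basis \<open>B0\<close>, hence is 0.\<close>
  have inj: "inj_on f (vs1.span ?C)"
  proof (rule inj_onI)
    fix u v assume uv: "u \<in> vs1.span ?C" "v \<in> vs1.span ?C" "f u = f v"
    have d: "u - v \<in> vs1.span ?C" using uv by (simp add: vs1.span_diff)
    then have "u - v \<in> S" using spB vs1.span_mono[of ?C B] by blast
    then have "u - v \<in> vs1.span B0" using uv B0(3) by (auto simp: f.diff)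
    then have "u - v = 0"
      using vs1.span_Int_span_eq_0[OF B(3), of ?C B0] B(1) d by blast
    then show "u = v" by simp
  qed
  have ind: "vs2.independent (f ` ?C)"
    using f.independent_injective_image[OF vs1.independent_mono[OF B(3)] inj] by blast
  have "f ` S \<subseteq> vs2.span (f ` B)" using B(4) by (rule f.spans_image)
  \<comment> \<open>The kernel basis \<open>B0\<close> is mapped to 0, and inserting 0 does not
    change a span.\<close>
  also have "\<dots> \<subseteq> vs2.span (insert 0 (f ` ?C))"
    using B0(1) by (intro vs2.span_mono) auto
  finally have "f ` S \<subseteq> vs2.span (f ` ?C)" by simp
  then have "card (f ` ?C) = vs2.dim (f ` S)"
    using B(2) ind by (intro vs2.basis_card_eq_dim) auto
  moreover have "card (f ` ?C) = card ?C"
    by (rule card_image[OF inj_on_subset[OF inj vs1.span_superset]])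
  moreover have "card B = vs1.dim S"
    using B by (intro vs1.basis_card_eq_dim) auto
  moreover have "card B = card B0 + card ?C"
    using card_Diff_subset[OF B0(4) B(1)] card_mono[OF fB B(1)] by linarith
  ultimately show ?thesis using B0(5) by linarith
qed

end

lemma vect_pair:
  "vector_space_pair (vscale :: 'k::field \<Rightarrow> 'k vect \<Rightarrow> 'k vect) (vscale :: 'k \<Rightarrow> 'k vect \<Rightarrow> 'k vect)"
  by unfold_locales

lemmas vect_dim_kernel_plus_image = vector_space_pair.dim_kernel_plus_image[OF vect_pair]

text \<open>Quotients have to be realised inside the sequence space again. A basis of
  \<open>N\<close> is extended to one of the whole space; \<open>p\<close> kills the former and
  fixes the added vectors, so \<open>p v\<close> is a representative of \<open>v\<close> modulo
  \<open>N\<close>.\<close>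

lemma projection_along_subspace:
  fixes N :: "'k::field vect set"
  assumes "vect.subspace N"
  obtains p where "Vector_Spaces.linear vscale vscale p" "\<And>v. p v = 0 \<longleftrightarrow> v \<in> N" "\<And>v. v - p v \<in> N"
proof -
  obtain B0 where B0: "B0 \<subseteq> N" "vect.independent B0" "N \<subseteq> vect.span B0" "card B0 = vect.dim N"
    by (rule vect.basis_exists[of N])
  obtain B where B: "B0 \<subseteq> B" "B \<subseteq> UNIV" "vect.independent B" "UNIV \<subseteq> vect.span B"
    by (rule vect.maximal_independent_subset_extend[OF subset_UNIV B0(2)])
  obtain p where p: "Vector_Spaces.linear vscale vscale p" "\<forall>b\<in>B. p b = (if b \<in> B0 then 0 else b)"
    using vector_space_pair.linear_independent_extend[OF vect_pair B(3),
        where f = "\<lambda>b. if b \<in> B0 then 0 else b"] by blast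
  interpret p: Vector_Spaces.linear vscale vscale p by fact
  have d: "v - p v \<in> N" for v
  proof -
    have "v \<in> vect.span B" using B(4) by blast
    then show ?thesis
    proof (induct rule: vect.span_induct_alt)
      case base
      show ?case by (simp only: p.zero diff_self vect.subspace_0[OF assms])
    next
      case (step c x y)
      have "x - p x \<in> N"
        using step(1) p(2) B0(1) vect.subspace_0[OF assms] by (cases "x \<in> B0") auto
      then have "vscale c (x - p x) + (y - p y) \<in> N"
        by (intro vect.subspace_add[OF assms] vect.subspace_scale[OF assms] step(2))
      moreover have "vscale c x + y - p (vscale c x + y) = vscale c (x - p x) + (y - p y)"
        by (simp add: p.add p.scale vect.scale_right_diff_distrib)
      ultimately show ?case by (simp only:)
    qed
  qed
  have "p v = 0" if "v \<in> N" for v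
  proof (rule p.eq_0_on_span[of B0])
    show "p b = 0" if "b \<in> B0" for b using that p(2) B(1) by auto
    show "v \<in> vect.span B0" using that B0(3) by blast
  qed
  moreover have "v \<in> N" if "p v = 0" for v
    using d[of v] that by (simp only: diff_zero)
  ultimately have "p v = 0 \<longleftrightarrow> v \<in> N" for v by blast
  then show ?thesis by (rule that[OF p(1) _ d])
qed

section \<open>Piecewise polynomially spanned subspaces\<close>

lemma vect_linearI:
  fixes f :: "'k::field vect \<Rightarrow> 'k vect"
  assumes "\<And>u v. f (u + v) = f u + f v" "\<And>c v. f (vscale c v) = vscale c (f v)"
  shows "Vector_Spaces.linear vscale vscale f"
  by unfold_locales (simp_all only: assms)

lemma vect_linear_coord: "Vector_Spaces.linear vscale (*) (\<lambda>v::'k::field vect. v i)"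
  by unfold_locales (simp_all add: vscale_def algebra_simps)

lemma subspace_coord_kernel:
  assumes "vect.subspace S"
  shows "vect.subspace {v \<in> S. v i = 0}"
  using assms by (simp add: vect.subspace_def vscale_def)

definition unit_vect :: "nat \<Rightarrow> 'k::field vect" where
  "unit_vect i = (\<lambda>j. if j = i then 1 else 0)"

lemma supported_eq_span_unit_vect:
  "{v. \<forall>i\<ge>n. v i = 0} = vect.span (unit_vect ` {..<n} :: 'k::field vect set)"
proof (rule subset_antisym)
  show "{v. \<forall>i\<ge>n. v i = 0} \<subseteq> vect.span (unit_vect ` {..<n} :: 'k vect set)"
  proof
    fix v :: "'k vect" assume v: "v \<in> {v. \<forall>i\<ge>n. v i = 0}"
    have "v = (\<Sum>i<n. vscale (v i) (unit_vect i))"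
    proof
      fix j
      have "(\<Sum>i<n. vscale (v i) (unit_vect i)) j = (\<Sum>i<n. vscale (v i) (unit_vect i) j)"
        by (induct n) simp_all
      also have "\<dots> = (\<Sum>i<n. if j = i then v i else 0)"
        by (intro sum.cong) (simp_all add: vscale_def unit_vect_def)
      also have "\<dots> = v j" using v by simp
      finally show "v j = (\<Sum>i<n. vscale (v i) (unit_vect i)) j" by (rule sym)
    qed
    also have "\<dots> \<in> vect.span (unit_vect ` {..<n})"
      by (intro vect.span_sum vect.span_scale vect.span_base) simp
    finally show "v \<in> vect.span (unit_vect ` {..<n})" .
  qed
  show "vect.span (unit_vect ` {..<n} :: 'k vect set) \<subseteq> {v. \<forall>i\<ge>n. v i = 0}"
    by (rule vect.span_minimal) (auto simp: unit_vect_def vect.subspace_def vscale_def)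
qed

lemma fd_subspaceI:
  assumes "vect.subspace V" "V \<subseteq> vect.span W" "finite W"
  shows "fd_subspace V"
  unfolding fd_subspace_def using assms(1) vect.subspace_finite_span[OF assms] by (rule conjI)

lemma fd_subspace_subset:
  assumes "vect.subspace V" "V \<subseteq> U" "fd_subspace U"
  shows "fd_subspace V"
proof -
  obtain W where "finite W" "U = vect.span W" using assms(3) unfolding fd_subspace_def by blast
  then show ?thesis using assms(1,2) by (intro fd_subspaceI[of V W]) simp_all
qed

text \<open>Pairs of sequences are coded as single sequences, with the components in the even and the odd
  places.\<close>

definition interleave :: "'k::field vect \<Rightarrow> 'k vect \<Rightarrow> 'k vect" where
  "interleave u v = (\<lambda>i. if even i then u (i div 2) else v (i div 2))"

definition evens :: "'k::field vect \<Rightarrow> 'k vect" where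
  "evens u = (\<lambda>i. u (2 * i))"

lemma interleave_add: "interleave (u + u') (v + v') = interleave u v + interleave u' v'"
  by (rule ext) (simp add: interleave_def)

lemma interleave_scale: "interleave (vscale c u) (vscale c v) = vscale c (interleave u v)"
  by (rule ext) (simp add: interleave_def vscale_def)

lemma evens_interleave [simp]: "evens (interleave u v) = u"
  by (rule ext) (simp add: interleave_def evens_def)

lemma interleave_odd_eq_0_iff: "(\<forall>i. interleave u v (2 * i + 1) = 0) \<longleftrightarrow> v = 0"
  by (auto simp: interleave_def fun_eq_iff)

text \<open>\<open>R\<close> is the parameter space, \<open>P\<close> stands for the polynomial
  functions on it and \<open>C\<close> for its constructible subsets. The linear algebra rests on
  these closure properties alone, away from topology and matrices. By \<open>P_cong\<close>,
  membership in \<open>P\<close> depends only on the values on \<open>R\<close>.\<close>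

locale constructible_algebra =
  fixes R :: "'a set" and P :: "('a \<Rightarrow> 'k::field) set" and C :: "'a set \<Rightarrow> bool"
  assumes P_const: "(\<lambda>_. c) \<in> P"
    and P_add: "p \<in> P \<Longrightarrow> q \<in> P \<Longrightarrow> (\<lambda>A. p A + q A) \<in> P"
    and P_mult: "p \<in> P \<Longrightarrow> q \<in> P \<Longrightarrow> (\<lambda>A. p A * q A) \<in> P"
    and P_cong: "p \<in> P \<Longrightarrow> (\<And>A. A \<in> R \<Longrightarrow> p A = q A) \<Longrightarrow> q \<in> P"
    and C_zero: "p \<in> P \<Longrightarrow> C {A \<in> R. p A = 0}"
    and C_Int: "C D \<Longrightarrow> C E \<Longrightarrow> C (D \<inter> E)"
    and C_compl: "C D \<Longrightarrow> C (R - D)"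
    and C_subset: "C D \<Longrightarrow> D \<subseteq> R"
begin

lemma P_diff:
  assumes "p \<in> P" "q \<in> P"
  shows "(\<lambda>A. p A - q A) \<in> P"
  using P_add[OF assms(1) P_mult[OF P_const[of "-1"] assms(2)]] by simp

lemma P_sum: "finite I \<Longrightarrow> (\<And>i. i \<in> I \<Longrightarrow> p i \<in> P) \<Longrightarrow> (\<lambda>A. \<Sum>i\<in>I. p i A) \<in> P"
  by (induct rule: finite_induct) (simp_all add: P_const P_add)

lemma C_UNIV: "C R"
  using C_zero[OF P_const[of 0]] by simp

lemma C_empty: "C {}"
  using C_compl[OF C_UNIV] by simp

lemma C_Un:
  assumes "C D" "C E"
  shows "C (D \<union> E)"
proof -
  have "D \<union> E = R - ((R - D) \<inter> (R - E))" using C_subset assms by blast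
  then show ?thesis using C_compl[OF C_Int[OF C_compl[OF assms(1)] C_compl[OF assms(2)]]] by simp
qed

lemma C_const: "C {A \<in> R. b}"
  by (cases b) (simp_all add: C_UNIV C_empty)

lemma C_conj: "C {A \<in> R. p A} \<Longrightarrow> C {A \<in> R. q A} \<Longrightarrow> C {A \<in> R. p A \<and> q A}"
  using C_Int[of "{A \<in> R. p A}" "{A \<in> R. q A}"] by (simp add: Int_def conj_ac cong: conj_cong)

lemma C_finite_Ball:
  "finite I \<Longrightarrow> (\<And>i. i \<in> I \<Longrightarrow> C {A \<in> R. p i A}) \<Longrightarrow> C {A \<in> R. \<forall>i\<in>I. p i A}"
  by (induct rule: finite_induct) (simp_all add: C_UNIV C_conj)

lemma C_finite_UN: "finite I \<Longrightarrow> (\<And>i. i \<in> I \<Longrightarrow> C (D i)) \<Longrightarrow> C (\<Union>i\<in>I. D i)"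
  by (induct rule: finite_induct) (simp_all add: C_empty C_Un)

text \<open>Finiteness of the range is part of the notion: it turns any condition on the values into
  a finite union of fibres, and it later yields a dimension bound that is uniform in the
  parameter.\<close>

definition constructible_fun :: "('a \<Rightarrow> 'b) \<Rightarrow> bool" where
  "constructible_fun f \<longleftrightarrow> finite (f ` R) \<and> (\<forall>x. C {A \<in> R. f A = x})"

lemma constructible_fun_pred:
  assumes "constructible_fun f"
  shows "C {A \<in> R. p (f A)}"
proof -
  have "{A \<in> R. p (f A)} = (\<Union>x\<in>{x \<in> f ` R. p x}. {A \<in> R. f A = x})" by auto
  also have "C \<dots>"
    using assms unfolding constructible_fun_def by (intro C_finite_UN) simp_all
  finally show ?thesis .
qed

lemma constructible_fun_const: "constructible_fun (\<lambda>_. c)"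
  unfolding constructible_fun_def by (simp add: C_const image_constant_conv)

lemma constructible_fun_if:
  assumes "C {A \<in> R. p A}"
  shows "constructible_fun (\<lambda>A. if p A then x else y)"
  unfolding constructible_fun_def
proof (intro conjI allI)
  show "finite ((\<lambda>A. if p A then x else y) ` R)"
    by (rule finite_subset[of _ "{x, y}"]) auto
  fix z
  have "C {A \<in> R. \<not> p A}" using C_compl[OF assms] by (simp add: set_diff_eq cong: conj_cong)
  then have "C (({A \<in> R. p A} \<inter> {A \<in> R. x = z}) \<union> ({A \<in> R. \<not> p A} \<inter> {A \<in> R. y = z}))"
    by (intro C_Un C_Int assms C_const)
  moreover have "({A \<in> R. p A} \<inter> {A \<in> R. x = z}) \<union> ({A \<in> R. \<not> p A} \<inter> {A \<in> R. y = z})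
      = {A \<in> R. (if p A then x else y) = z}" by auto
  ultimately show "C {A \<in> R. (if p A then x else y) = z}" by simp
qed

lemma constructible_fun_cong:
  assumes "constructible_fun f" "\<And>A. A \<in> R \<Longrightarrow> f A = g A"
  shows "constructible_fun g"
proof -
  have "g ` R = f ` R" "\<And>x. {A \<in> R. g A = x} = {A \<in> R. f A = x}" using assms(2) by auto
  then show ?thesis using assms(1) unfolding constructible_fun_def by simp
qed

lemma constructible_fun_comp2:
  assumes f: "constructible_fun f" and g: "constructible_fun g"
  shows "constructible_fun (\<lambda>A. h (f A) (g A))"
  unfolding constructible_fun_def
proof (intro conjI allI)
  have "(\<lambda>A. h (f A) (g A)) ` R \<subseteq> (\<lambda>(x, y). h x y) ` (f ` R \<times> g ` R)" by auto
  then show "finite ((\<lambda>A. h (f A) (g A)) ` R)"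
    using f g unfolding constructible_fun_def by (meson finite_SigmaI finite_imageI finite_subset)
  fix z
  have "{A \<in> R. h (f A) (g A) = z}
      = (\<Union>x\<in>f ` R. {A \<in> R. f A = x} \<inter> {A \<in> R. h x (g A) = z})" by auto
  also have "C \<dots>"
    using f constructible_fun_pred[OF g] unfolding constructible_fun_def
    by (intro C_finite_UN C_Int) simp_all
  finally show "C {A \<in> R. h (f A) (g A) = z}" .
qed

section \<open>Polynomially varying vectors and linear maps\<close>

text \<open>The bound \<open>N\<close> is uniform in the parameter, so such a vector is a finite
  tuple of polynomials padded with zeros.\<close>

definition poly_vec :: "('a \<Rightarrow> 'k vect) \<Rightarrow> bool" where
  "poly_vec w \<longleftrightarrow> (\<exists>N. \<forall>A\<in>R. \<forall>i\<ge>N. w A i = 0) \<and> (\<forall>i. (\<lambda>A. w A i) \<in> P)"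

lemma poly_vec_coord: "poly_vec w \<Longrightarrow> (\<lambda>A. w A i) \<in> P"
  unfolding poly_vec_def by blast

lemma poly_vec_const: "(\<forall>i\<ge>n. v i = 0) \<Longrightarrow> poly_vec (\<lambda>_. v)"
  unfolding poly_vec_def by (blast intro: P_const)

lemma poly_vec_zero: "poly_vec (\<lambda>_. 0)"
  by (rule poly_vec_const[of 0]) simp

text \<open>\<open>h0\<close> says that \<open>u\<close> is supported where \<open>w\<close> or
  \<open>w'\<close> is, so the larger of their bounds serves for \<open>u\<close>.\<close>

lemma poly_vec_combine:
  assumes w: "poly_vec w" "poly_vec w'"
    and h0: "\<And>A i. A \<in> R \<Longrightarrow> w A i = 0 \<Longrightarrow> w' A i = 0 \<Longrightarrow> u A i = 0"
    and P: "\<And>i. (\<lambda>A. u A i) \<in> P"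
  shows "poly_vec u"
proof -
  obtain N N' where "\<forall>A\<in>R. \<forall>i\<ge>N. w A i = 0" "\<forall>A\<in>R. \<forall>i\<ge>N'. w' A i = 0"
    using w unfolding poly_vec_def by blast
  then have "\<forall>A\<in>R. \<forall>i\<ge>max N N'. u A i = 0" using h0 by simp
  then show ?thesis using P unfolding poly_vec_def by blast
qed

lemma poly_vec_add: "poly_vec w \<Longrightarrow> poly_vec w' \<Longrightarrow> poly_vec (\<lambda>A. w A + w' A)"
  by (rule poly_vec_combine[of w w']) (simp_all add: P_add poly_vec_coord)

lemma poly_vec_sum:
  "finite I \<Longrightarrow> (\<And>i. i \<in> I \<Longrightarrow> poly_vec (w i)) \<Longrightarrow> poly_vec (\<lambda>A. \<Sum>i\<in>I. w i A)"
  by (induct rule: finite_induct) (simp_all only: sum.empty sum.insert poly_vec_zero poly_vec_add insert_iff simp_thms)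

lemma poly_vec_eliminate:
  "poly_vec w \<Longrightarrow> poly_vec w' \<Longrightarrow>
    poly_vec (\<lambda>A. vscale (w A i) (w' A) - vscale (w' A i) (w A))"
  by (rule poly_vec_combine[of w w']) (simp_all add: vscale_def P_diff P_mult poly_vec_coord)

lemma poly_vec_interleave:
  assumes "poly_vec w" "poly_vec w'"
  shows "poly_vec (\<lambda>A. interleave (w A) (w' A))"
proof -
  obtain N N' where "\<forall>A\<in>R. \<forall>i\<ge>N. w A i = 0" "\<forall>A\<in>R. \<forall>i\<ge>N'. w' A i = 0"
    using assms unfolding poly_vec_def by blast
  then have "\<forall>A\<in>R. \<forall>i\<ge>2 * max N N'. interleave (w A) (w' A) i = 0"
    by (auto simp: interleave_def)
  moreover have "(\<lambda>A. interleave (w A) (w' A) i) \<in> P" for i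
    using poly_vec_coord[OF assms(1)] poly_vec_coord[OF assms(2)]
    by (cases "even i") (simp_all add: interleave_def)
  ultimately show ?thesis unfolding poly_vec_def by blast
qed

text \<open>Phrased by the effect on polynomial vectors instead of by matrix entries: composition is
  then immediate, and maps such as \<open>incl\<close>, which only move coordinates around, need no
  matrix.\<close>

definition poly_map :: "('a \<Rightarrow> 'k vect \<Rightarrow> 'k vect) \<Rightarrow> bool" where
  "poly_map f \<longleftrightarrow> (\<forall>A\<in>R. Vector_Spaces.linear vscale vscale (f A)) \<and>
     (\<forall>w. poly_vec w \<longrightarrow> poly_vec (\<lambda>A. f A (w A)))"

lemma poly_mapD:
  assumes "poly_map f"
  shows "A \<in> R \<Longrightarrow> Vector_Spaces.linear vscale vscale (f A)" "poly_vec w \<Longrightarrow> poly_vec (\<lambda>A. f A (w A))"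
  using assms unfolding poly_map_def by blast+

lemma poly_map_id: "poly_map (\<lambda>A v. v)"
  unfolding poly_map_def by (simp add: vect_linearI)

lemma poly_map_evens: "poly_map (\<lambda>A. evens)"
  unfolding poly_map_def
proof (intro conjI ballI allI impI)
  show "Vector_Spaces.linear vscale vscale (evens :: 'k vect \<Rightarrow> 'k vect)"
    by (rule vect_linearI; rule ext) (simp_all add: evens_def vscale_def)
  fix w :: "'a \<Rightarrow> 'k vect" assume w: "poly_vec w"
  then obtain N where "\<forall>A\<in>R. \<forall>i\<ge>N. w A i = 0" unfolding poly_vec_def by blast
  then have "\<forall>A\<in>R. \<forall>i\<ge>N. evens (w A) i = 0" by (simp add: evens_def)
  then show "poly_vec (\<lambda>A. evens (w A))"
    using poly_vec_coord[OF w] unfolding poly_vec_def evens_def by blast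
qed

lemma poly_map_interleave:
  assumes "poly_map f" "poly_map g"
  shows "poly_map (\<lambda>A v. interleave (f A v) (g A v))"
  unfolding poly_map_def
proof (intro conjI ballI allI impI)
  show "poly_vec (\<lambda>A. interleave (f A (w A)) (g A (w A)))" if "poly_vec w" for w
    using poly_mapD(2)[OF assms(1) that] poly_mapD(2)[OF assms(2) that] by (rule poly_vec_interleave)
  fix A assume A: "A \<in> R"
  interpret f: Vector_Spaces.linear vscale vscale "f A" using assms(1) A by (rule poly_mapD)
  interpret g: Vector_Spaces.linear vscale vscale "g A" using assms(2) A by (rule poly_mapD)
  show "Vector_Spaces.linear vscale vscale (\<lambda>v. interleave (f A v) (g A v))"
    by (rule vect_linearI) (simp_all only: f.add g.add f.scale g.scale interleave_add interleave_scale)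
qed

lemma poly_map_zero: "poly_map (\<lambda>A v. 0)"
  unfolding poly_map_def
  by (intro conjI ballI allI impI vect_linearI poly_vec_zero)
    (simp_all only: add_0 vect.scale_zero_right)

section \<open>Families of subspaces and the operations on them\<close>

text \<open>\<open>piecewise\<close> records a cut of the parameter space; both branches may be cut
  again, so finitely many pieces arise. Through \<open>equal\<close> only the subspaces over
  \<open>R\<close> count, and no choice of generators belongs to a family.\<close>

inductive subspace_family :: "('a \<Rightarrow> 'k vect set) \<Rightarrow> bool" where
  span: "finite W \<Longrightarrow> (\<And>w. w \<in> W \<Longrightarrow> poly_vec w) \<Longrightarrow>
    subspace_family (\<lambda>A. vect.span ((\<lambda>w. w A) ` W))"
| piecewise: "C D \<Longrightarrow> subspace_family S \<Longrightarrow> subspace_family T \<Longrightarrow>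
    subspace_family (\<lambda>A. if A \<in> D then S A else T A)"
| equal: "subspace_family S \<Longrightarrow> (\<And>A. A \<in> R \<Longrightarrow> S A = T A) \<Longrightarrow> subspace_family T"

text \<open>An operation applied separately at each parameter commutes with cutting, so only
  families with generators given on all of \<open>R\<close> have to be treated.\<close>

lemma subspace_family_map:
  assumes "subspace_family S"
    and "\<And>W. finite W \<Longrightarrow> (\<And>w. w \<in> W \<Longrightarrow> poly_vec w) \<Longrightarrow>
      subspace_family (\<lambda>A. F A (vect.span ((\<lambda>w. w A) ` W)))"
  shows "subspace_family (\<lambda>A. F A (S A))"
  using assms(1)
proof induct
  case (span W)
  then show ?case by (rule assms(2))
next
  case (piecewise D S T)
  then have "subspace_family (\<lambda>A. if A \<in> D then F A (S A) else F A (T A))"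
    by (intro subspace_family.piecewise)
  then show ?case by (rule subspace_family.equal) simp
next
  case (equal S T)
  from equal(2) show ?case by (rule subspace_family.equal) (simp add: equal(3))
qed

lemma C_subspace_family:
  assumes "subspace_family S"
    and "\<And>W. finite W \<Longrightarrow> (\<And>w. w \<in> W \<Longrightarrow> poly_vec w) \<Longrightarrow>
      C {A \<in> R. p A (vect.span ((\<lambda>w. w A) ` W))}"
  shows "C {A \<in> R. p A (S A)}"
  using assms(1)
proof induct
  case (span W)
  then show ?case by (rule assms(2))
next
  case (piecewise D S T)
  have "C (D \<inter> {A \<in> R. p A (S A)} \<union> (R - D) \<inter> {A \<in> R. p A (T A)})"
    by (intro C_Un C_Int C_compl piecewise)
  moreover have "D \<inter> {A \<in> R. p A (S A)} \<union> (R - D) \<inter> {A \<in> R. p A (T A)}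
      = {A \<in> R. p A (if A \<in> D then S A else T A)}"
    by auto
  ultimately show ?case by simp
next
  case (equal S T)
  have "{A \<in> R. p A (T A)} = {A \<in> R. p A (S A)}" using equal(3) by auto
  then show ?case using equal(2) by simp
qed

lemma subspace_family_fd:
  assumes "subspace_family S" "A \<in> R"
  shows "fd_subspace (S A)"
  using assms
proof induct
  case (span W)
  then show ?case unfolding fd_subspace_def by blast
qed simp_all

lemma subspace_family_subspace: "subspace_family S \<Longrightarrow> A \<in> R \<Longrightarrow> vect.subspace (S A)"
  using subspace_family_fd unfolding fd_subspace_def by blast

lemma subspace_family_bounded:
  assumes "subspace_family S"
  shows "\<exists>N. \<forall>A\<in>R. \<forall>v\<in>S A. \<forall>i\<ge>N. v i = 0"
  using assms
proof induct
  case (span W)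
  have "\<forall>w\<in>W. \<exists>N. \<forall>A\<in>R. \<forall>i\<ge>N. w A i = 0" using span(2) unfolding poly_vec_def by blast
  then obtain f where f: "\<forall>w\<in>W. \<forall>A\<in>R. \<forall>i\<ge>f w. w A i = 0" by metis
  \<comment> \<open>For empty \<open>W\<close> this value is unspecified, but then there is no
    generator to bound.\<close>
  let ?N = "Max (f ` W)"
  have "vect.span ((\<lambda>w. w A) ` W) \<subseteq> {v. \<forall>i\<ge>?N. v i = 0}" if "A \<in> R" for A
  proof (rule vect.span_minimal)
    show "(\<lambda>w. w A) ` W \<subseteq> {v. \<forall>i\<ge>?N. v i = 0}"
    proof (intro subsetI CollectI allI impI)
      fix v i assume "v \<in> (\<lambda>w. w A) ` W" "i \<ge> ?N"
      then obtain w where w: "w \<in> W" "v = w A" by blast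
      have "f w \<le> ?N" using w(1) span(1) by simp
      then show "v i = 0" using f \<open>A \<in> R\<close> w \<open>i \<ge> ?N\<close> by simp
    qed
    show "vect.subspace {v::'k vect. \<forall>i\<ge>?N. v i = 0}"
      by (simp add: vect.subspace_def vscale_def)
  qed
  then show ?case by (intro exI[of _ ?N]) auto
next
  case (piecewise D S T)
  then obtain N N' where "\<forall>A\<in>R. \<forall>v\<in>S A. \<forall>i\<ge>N. v i = 0" "\<forall>A\<in>R. \<forall>v\<in>T A. \<forall>i\<ge>N'. v i = 0"
    by blast
  then have "\<forall>A\<in>R. \<forall>v\<in>(if A \<in> D then S A else T A). \<forall>i\<ge>max N N'. v i = 0" by simp
  then show ?case by (rule exI)
qed simp

text \<open>The sets \<open>D w\<close> may overlap, because every \<open>T w\<close> agrees with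
  \<open>S\<close> on its own set. In the induction the case of the new element is absorbed into the
  default family \<open>S0\<close>, which is therefore generalised.\<close>

lemma subspace_family_cases:
  assumes "finite U" "\<And>w. w \<in> U \<Longrightarrow> C (D w)" "\<And>w. w \<in> U \<Longrightarrow> subspace_family (T w)"
    and "subspace_family S0"
    and "\<And>A w. A \<in> R \<Longrightarrow> w \<in> U \<Longrightarrow> A \<in> D w \<Longrightarrow> T w A = S A"
    and "\<And>A. A \<in> R \<Longrightarrow> (\<forall>w\<in>U. A \<notin> D w) \<Longrightarrow> S0 A = S A"
  shows "subspace_family S"
  using assms
proof (induct U arbitrary: S0 rule: finite_induct)
  case empty
  show ?case by (rule subspace_family.equal[OF empty(3)]) (rule empty(5), simp_all)
next
  case (insert u U)
  show ?case
  proof (rule insert(3))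
    show "subspace_family (\<lambda>A. if A \<in> D u then T u A else S0 A)"
      by (intro subspace_family.piecewise insert) simp_all
    show "(if A \<in> D u then T u A else S0 A) = S A" if "A \<in> R" "\<forall>w\<in>U. A \<notin> D w" for A
      using insert(7)[of A u] insert(8)[of A] that by simp
  qed (simp_all add: insert)
qed

text \<open>One step of fraction-free elimination: if the \<open>i\<close>-th coordinate of \<open>w\<close> does not vanish, then
  the vectors \<open>w\<^sub>i w' - w'\<^sub>i w\<close> span the vectors of the span whose \<open>i\<close>-th coordinate vanishes.\<close>

lemma span_eliminate:
  assumes "w \<in> W" "w i \<noteq> 0"
  shows "vect.span ((\<lambda>w'. vscale (w i) w' - vscale (w' i) w) ` W) = {v \<in> vect.span W. v i = 0}"
    (is "vect.span (?g ` W) = ?K")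
proof (rule subset_antisym)
  have lin: "Vector_Spaces.linear vscale vscale ?g"
    by (rule vect_linearI; rule ext) (simp_all add: vscale_def algebra_simps)
  interpret g: Vector_Spaces.linear vscale vscale ?g by (rule lin)
  show "vect.span (?g ` W) \<subseteq> ?K"
  proof (rule vect.span_minimal)
    show "vect.subspace ?K" by (rule subspace_coord_kernel) simp
    show "?g ` W \<subseteq> ?K"
    proof
      fix x assume "x \<in> ?g ` W"
      then obtain w' where w': "w' \<in> W" "x = ?g w'" by blast
      have "x \<in> vect.span W"
        unfolding w'(2) by (intro vect.span_diff vect.span_scale vect.span_base w' assms)
      moreover have "x i = 0" unfolding w'(2) by (simp add: vscale_def)
      ultimately show "x \<in> ?K" by simp
    qed
  qed
  show "?K \<subseteq> vect.span (?g ` W)"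
  proof
    fix v assume v: "v \<in> ?K"
    \<comment> \<open>Since \<open>v i = 0\<close>, elimination only multiplies \<open>v\<close> by
      the nonzero scalar \<open>w i\<close>, which can be divided out.\<close>
    have "?g v = vscale (w i) v" using v by (simp add: vscale_def fun_eq_iff)
    moreover have "?g v \<in> vect.span (?g ` W)" unfolding g.span_image using v by blast
    ultimately have "vscale (inverse (w i)) (vscale (w i) v) \<in> vect.span (?g ` W)"
      by (simp only: vect.span_scale)
    then show "v \<in> vect.span (?g ` W)" using assms(2) by simp
  qed
qed

text \<open>The only operation that creates new pieces: they tell which generator \<open>w\<close>
  can serve as a pivot at coordinate \<open>i\<close>. Where there is none, all generators lie in
  the kernel and the span stays as it is.\<close>

lemma subspace_family_coord_kernel:
  assumes "subspace_family S"
  shows "subspace_family (\<lambda>A. {v \<in> S A. v i = 0})"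
proof (rule subspace_family_map[OF assms, where F = "\<lambda>A V. {v \<in> V. v i = 0}"])
  fix W :: "('a \<Rightarrow> 'k vect) set" assume W: "finite W" "\<And>w. w \<in> W \<Longrightarrow> poly_vec w"
  let ?g = "\<lambda>w w' A. vscale (w A i) (w' A) - vscale (w' A i) (w A)"
  show "subspace_family (\<lambda>A. {v \<in> vect.span ((\<lambda>w. w A) ` W). v i = 0})"
  proof (rule subspace_family_cases[OF W(1)])
    fix w assume w: "w \<in> W"
    show "C (R - {A \<in> R. w A i = 0})"
      by (intro C_compl C_zero poly_vec_coord W w)
    show "subspace_family (\<lambda>A. vect.span ((\<lambda>u. u A) ` ?g w ` W))"
      using W w by (intro subspace_family.span) (auto intro: poly_vec_eliminate)
    fix A assume A: "A \<in> R" "A \<in> R - {A \<in> R. w A i = 0}"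
    show "vect.span ((\<lambda>u. u A) ` ?g w ` W) = {v \<in> vect.span ((\<lambda>w. w A) ` W). v i = 0}"
      using span_eliminate[of "w A" "(\<lambda>w. w A) ` W" i] A w by (simp add: image_image)
  next
    show "subspace_family (\<lambda>A. vect.span ((\<lambda>w. w A) ` W))"
      using W by (rule subspace_family.span)
    fix A assume A: "A \<in> R" "\<forall>w\<in>W. A \<notin> R - {A \<in> R. w A i = 0}"
    have "vect.span ((\<lambda>w. w A) ` W) \<subseteq> {v \<in> vect.span ((\<lambda>w. w A) ` W). v i = 0}"
    proof (rule vect.span_minimal)
      show "vect.subspace {v \<in> vect.span ((\<lambda>w. w A) ` W). v i = 0}"
        by (rule subspace_coord_kernel) simp
      show "(\<lambda>w. w A) ` W \<subseteq> {v \<in> vect.span ((\<lambda>w. w A) ` W). v i = 0}"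
        using A by (auto intro: vect.span_base)
    qed
    then show "vect.span ((\<lambda>w. w A) ` W) = {v \<in> vect.span ((\<lambda>w. w A) ` W). v i = 0}" by blast
  qed
qed

lemma subspace_family_coords_kernel:
  assumes "finite I" "subspace_family S"
  shows "subspace_family (\<lambda>A. {v \<in> S A. \<forall>i\<in>I. v i = 0})"
  using assms
proof (induct rule: finite_induct)
  case empty
  then show ?case by simp
next
  case (insert i I)
  have "subspace_family (\<lambda>A. {v \<in> {v \<in> S A. \<forall>i\<in>I. v i = 0}. v i = 0})"
    by (intro subspace_family_coord_kernel insert)
  then show ?case by (rule subspace_family.equal) auto
qed

lemma subspace_family_image:
  assumes "subspace_family S" "poly_map f"
  shows "subspace_family (\<lambda>A. f A ` S A)"
proof (rule subspace_family_map[OF assms(1), where F = "\<lambda>A V. f A ` V"])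
  fix W :: "('a \<Rightarrow> 'k vect) set" assume W: "finite W" "\<And>w. w \<in> W \<Longrightarrow> poly_vec w"
  have "subspace_family (\<lambda>A. vect.span ((\<lambda>u. u A) ` (\<lambda>w A. f A (w A)) ` W))"
    using W by (intro subspace_family.span) (auto intro: poly_mapD(2)[OF assms(2)])
  then show "subspace_family (\<lambda>A. f A ` vect.span ((\<lambda>w. w A) ` W))"
  proof (rule subspace_family.equal)
    fix A assume "A \<in> R"
    then interpret f: Vector_Spaces.linear vscale vscale "f A" by (rule poly_mapD[OF assms(2)])
    show "vect.span ((\<lambda>u. u A) ` (\<lambda>w A. f A (w A)) ` W) = f A ` vect.span ((\<lambda>w. w A) ` W)"
      unfolding f.span_image[symmetric] by (simp add: image_image)
  qed
qed

lemma subspace_family_zero: "subspace_family (\<lambda>_. {0})"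
  using subspace_family.span[of "{}"] by simp

lemma subspace_family_plus:
  assumes "subspace_family S" "subspace_family T"
  shows "subspace_family (\<lambda>A. {u + v | u v. u \<in> S A \<and> v \<in> T A})"
proof (rule subspace_family_map[OF assms(1), where F = "\<lambda>A V. {u + v | u v. u \<in> V \<and> v \<in> T A}"])
  fix W :: "('a \<Rightarrow> 'k vect) set" assume W: "finite W" "\<And>w. w \<in> W \<Longrightarrow> poly_vec w"
  show "subspace_family (\<lambda>A. {u + v | u v. u \<in> vect.span ((\<lambda>w. w A) ` W) \<and> v \<in> T A})"
  proof (rule subspace_family_map[OF assms(2),
        where F = "\<lambda>A V. {u + v | u v. u \<in> vect.span ((\<lambda>w. w A) ` W) \<and> v \<in> V}"])
    fix W' :: "('a \<Rightarrow> 'k vect) set" assume W': "finite W'" "\<And>w. w \<in> W' \<Longrightarrow> poly_vec w"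
    have "subspace_family (\<lambda>A. vect.span ((\<lambda>w. w A) ` (W \<union> W')))"
      using W W' by (intro subspace_family.span) auto
    then show "subspace_family (\<lambda>A. {u + v | u v. u \<in> vect.span ((\<lambda>w. w A) ` W) \<and>
        v \<in> vect.span ((\<lambda>w. w A) ` W')})"
      by (simp only: image_Un vect.span_Un)
  qed
qed

text \<open>\<open>{v \<in> S. f v \<in> T}\<close> is the projection of the part of \<open>{(v, f v + t) | v t. v \<in> S \<and> t \<in> T}\<close> with
  second component \<open>0\<close>, so coordinate kernels and images suffice.\<close>

lemma subspace_family_preimage:
  assumes S: "subspace_family S" and T: "subspace_family T" and f: "poly_map f"
  shows "subspace_family (\<lambda>A. {v \<in> S A. f A v \<in> T A})"
proof -
  define G where "G A = {u + v | u v. u \<in> (\<lambda>v. interleave v (f A v)) ` S A \<and>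
    v \<in> (\<lambda>v. interleave 0 v) ` T A}" for A
  have G: "subspace_family G"
    unfolding G_def
    by (intro subspace_family_plus subspace_family_image poly_map_interleave S T f
        poly_map_id poly_map_zero)
  have mem: "x \<in> G A \<longleftrightarrow> (\<exists>u\<in>S A. \<exists>v\<in>T A. x = interleave u (f A u + v))" for x A
  proof -
    have "interleave u (f A u) + interleave 0 v = interleave u (f A u + v)" for u v
      by (simp only: interleave_add[symmetric] add_0_right)
    then have "x = interleave u (f A u + v) \<longleftrightarrow> x = interleave u (f A u) + interleave 0 v" for u v
      by (simp only:)
    then show ?thesis unfolding G_def by blast
  qed
  obtain N where N: "\<And>A v i. A \<in> R \<Longrightarrow> v \<in> G A \<Longrightarrow> i \<ge> N \<Longrightarrow> v i = 0"
    using subspace_family_bounded[OF G] by blast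
  \<comment> \<open>Finitely many odd places suffice: for \<open>i \<ge> N\<close> the place
    \<open>2 * i + 1\<close> lies beyond \<open>N\<close>, where all vectors of \<open>G A\<close>
    vanish anyway.\<close>
  let ?I = "(\<lambda>i. 2 * i + 1) ` {..<N}"
  have "subspace_family (\<lambda>A. evens ` {v \<in> G A. \<forall>i\<in>?I. v i = 0})"
    by (intro subspace_family_image subspace_family_coords_kernel G poly_map_evens) simp
  then show ?thesis
  proof (rule subspace_family.equal)
    fix A assume A: "A \<in> R"
    have TA: "vect.subspace (T A)" using T A by (rule subspace_family_subspace)
    have odd: "(\<forall>i\<in>?I. x i = 0) \<longleftrightarrow> (\<forall>i. x (2 * i + 1) = 0)" if "x \<in> G A" for x
    proof
      assume l: "\<forall>i\<in>?I. x i = 0"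
      show "\<forall>i. x (2 * i + 1) = 0"
      proof
        fix i
        show "x (2 * i + 1) = 0"
          using l N[OF A that, of "2 * i + 1"] by (cases "i < N") auto
      qed
    qed simp
    show "evens ` {v \<in> G A. \<forall>i\<in>?I. v i = 0} = {v \<in> S A. f A v \<in> T A}"
    proof (intro subset_antisym subsetI)
      fix x assume "x \<in> evens ` {v \<in> G A. \<forall>i\<in>?I. v i = 0}"
      then obtain y where y: "y \<in> G A" "\<forall>i. y (2 * i + 1) = 0" "x = evens y"
        using odd by blast
      then obtain u v where uv: "u \<in> S A" "v \<in> T A" "y = interleave u (f A u + v)"
        using mem by blast
      have "f A u + v = 0" using y(2) unfolding uv(3) interleave_odd_eq_0_iff .
      then have "f A u = - v" by (simp only: eq_neg_iff_add_eq_0)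
      then have "f A u \<in> T A" using vect.subspace_neg[OF TA uv(2)] by simp
      then show "x \<in> {v \<in> S A. f A v \<in> T A}" using uv(1) y(3) uv(3) by simp
    next
      fix x assume x: "x \<in> {v \<in> S A. f A v \<in> T A}"
      \<comment> \<open>The vector taken from \<open>T A\<close> is \<open>- f A x\<close>, which
        cancels the second component.\<close>
      let ?y = "interleave x (f A x + - f A x)"
      have y: "?y \<in> G A" using x vect.subspace_neg[OF TA] mem by blast
      moreover have "\<forall>i. ?y (2 * i + 1) = 0" unfolding interleave_odd_eq_0_iff by (simp only: add.right_inverse)
      ultimately have "?y \<in> {v \<in> G A. \<forall>i\<in>?I. v i = 0}" using odd by blast
      then have "evens ?y \<in> evens ` {v \<in> G A. \<forall>i\<in>?I. v i = 0}" by (rule imageI)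
      then show "x \<in> evens ` {v \<in> G A. \<forall>i\<in>?I. v i = 0}" by (simp only: evens_interleave)
    qed
  qed
qed

lemma subspace_family_Int:
  assumes "subspace_family S" "subspace_family T"
  shows "subspace_family (\<lambda>A. S A \<inter> T A)"
  using subspace_family_preimage[OF assms poly_map_id] by (simp add: Int_def)

text \<open>Induction on the support bound. Passing to the vectors with \<open>v N = 0\<close>
  lowers the bound by one, and lowers the dimension by one exactly where some vector of
  \<open>S A\<close> has a nonzero coordinate \<open>N\<close>. Whether this happens is decided by
  the generators, hence by finitely many polynomials.\<close>

lemma constructible_fun_dim:
  assumes "subspace_family S"
  shows "constructible_fun (\<lambda>A. vect.dim (S A))"
proof -
  obtain N where N: "\<forall>A\<in>R. \<forall>v\<in>S A. \<forall>i\<ge>N. v i = 0"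
    using subspace_family_bounded[OF assms] by blast
  show ?thesis
    using assms N
  proof (induct N arbitrary: S)
    case 0
    have "S A = {0}" if "A \<in> R" for A
    proof -
      have "v = 0" if "v \<in> S A" for v using 0(2) \<open>A \<in> R\<close> that by (simp add: fun_eq_iff)
      then show ?thesis
        using vect.subspace_0[OF subspace_family_subspace[OF 0(1) that]] by blast
    qed
    moreover have "vect.dim {0} = 0"
      using vect.dim_le_card[of "{0}" "{}"] by simp
    ultimately show ?case
      by (intro constructible_fun_cong[OF constructible_fun_const[of 0]]) simp
  next
    case (Suc N)
    let ?S' = "\<lambda>A. {v \<in> S A. v N = 0}"
    have "subspace_family ?S'" using Suc(2) by (rule subspace_family_coord_kernel)
    moreover have "\<forall>A\<in>R. \<forall>v\<in>?S' A. \<forall>i\<ge>N. v i = 0"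
      using Suc(3) by (metis (mono_tags, lifting) le_eq_less_or_eq mem_Collect_eq Suc_leI)
    ultimately have 1: "constructible_fun (\<lambda>A. vect.dim (?S' A))" by (rule Suc(1))
    have "C {A \<in> R. \<forall>v\<in>S A. v N = 0}"
    proof (rule C_subspace_family[OF Suc(2), where p = "\<lambda>A V. \<forall>v\<in>V. v N = 0"])
      fix W :: "('a \<Rightarrow> 'k vect) set" assume W: "finite W" "\<And>w. w \<in> W \<Longrightarrow> poly_vec w"
      have "(\<forall>v\<in>vect.span ((\<lambda>w. w A) ` W). v N = 0) \<longleftrightarrow> (\<forall>w\<in>W. w A N = 0)" for A
      proof
        assume "\<forall>w\<in>W. w A N = 0"
        then have "vect.span ((\<lambda>w. w A) ` W) \<subseteq> {v \<in> UNIV. v N = 0}"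
          by (intro vect.span_minimal subspace_coord_kernel) auto
        then show "\<forall>v\<in>vect.span ((\<lambda>w. w A) ` W). v N = 0" by blast
      qed (simp add: vect.span_base)
      then show "C {A \<in> R. \<forall>v\<in>vect.span ((\<lambda>w. w A) ` W). v N = 0}"
        using W by (simp add: C_finite_Ball C_zero poly_vec_coord)
    qed
    then have 2: "constructible_fun (\<lambda>A. if \<forall>v\<in>S A. v N = 0 then 0 else 1 :: nat)"
      by (rule constructible_fun_if)
    show ?case
    proof (rule constructible_fun_cong[OF constructible_fun_comp2[OF 1 2, of "(+)"]])
      fix A assume A: "A \<in> R"
      obtain W where W: "vect.subspace (S A)" "finite W" "S A \<subseteq> vect.span W"
        using subspace_family_fd[OF Suc(2) A] unfolding fd_subspace_def by blast
      show "vect.dim (?S' A) + (if \<forall>v\<in>S A. v N = 0 then 0 else 1) = vect.dim (S A)"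
      proof (cases "\<forall>v\<in>S A. v N = 0")
        case True
        then have "?S' A = S A" by blast
        then show ?thesis using True by simp
      next
        case False
        then obtain v where "v \<in> S A" "v N \<noteq> 0" by blast
        then have "vect.dim (S A) = Suc (vect.dim (?S' A))"
          by (rule vect.dim_kernel_functional[OF W(1,3,2) vect_linear_coord])
        then show ?thesis using False by simp
      qed
    qed
  qed
qed

end

section \<open>The global rank as a dimension\<close>

lemma quiverD:
  assumes "quiver Q"
  shows "finite (verts Q)" "finite (arcs Q)" "verts Q \<noteq> {}"
    "a \<in> arcs Q \<Longrightarrow> tail Q a \<in> verts Q" "a \<in> arcs Q \<Longrightarrow> head Q a \<in> verts Q"
proof -
  have fd: "fin_digraph Q" and conn: "Digraph_Component.connected Q"
    using assms unfolding quiver_def by blast+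
  show "finite (verts Q)" "finite (arcs Q)"
    by (rule fin_digraph.finite_verts[OF fd], rule fin_digraph.finite_arcs[OF fd])
  show "verts Q \<noteq> {}"
    using conn unfolding Digraph_Component.connected_def strongly_connected_def by simp
  have "wf_digraph Q" using fd by (rule fin_digraph.axioms(1))
  then show "a \<in> arcs Q \<Longrightarrow> tail Q a \<in> verts Q" "a \<in> arcs Q \<Longrightarrow> head Q a \<in> verts Q"
    by (simp_all only: wf_digraph.tail_in_verts wf_digraph.head_in_verts)
qed

text \<open>Connectedness is reachability in the symmetric closure, so each step of a path runs
  along an arrow or against one. The lemma is meant for the dimension of the image that defines the
  rank.\<close>

lemma quiver_constant_on_verts:
  assumes Q: "quiver Q" and eq: "\<And>a. a \<in> arcs Q \<Longrightarrow> f (tail Q a) = f (head Q a)"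
    and x: "x \<in> verts Q" and y: "y \<in> verts Q"
  shows "f x = f y"
proof -
  let ?G = "mk_symmetric Q"
  have "x \<rightarrow>\<^sup>*\<^bsub>with_proj ?G\<^esub> y"
    using Q x y unfolding quiver_def Digraph_Component.connected_def strongly_connected_def by simp
  then show ?thesis
    unfolding reachable_def
  proof (induct rule: rtrancl_on_induct)
    case (step u v)
    have "(u, v) \<in> parcs ?G" using step(2) by simp
    then have "f u = f v" unfolding parcs_mk_symmetric using eq by auto
    then show ?case using step(5) by simp
  qed simp
qed

lemma repD:
  assumes "\<phi> \<in> rep Q"
  shows "x \<in> verts Q \<Longrightarrow> fd_subspace (vsp \<phi> x)" "x \<in> verts Q \<Longrightarrow> vect.subspace (vsp \<phi> x)"
    "a \<in> arcs Q \<Longrightarrow> Vector_Spaces.linear vscale vscale (amap \<phi> a)"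
    "a \<in> arcs Q \<Longrightarrow> v \<in> vsp \<phi> (tail Q a) \<Longrightarrow> amap \<phi> a v \<in> vsp \<phi> (head Q a)"
  using assms unfolding rep_def linear_map_def fd_subspace_def by blast+

section \<open>Subrepresentations and quotients described by subspaces\<close>

text \<open>A subrepresentation is determined by its spaces, its maps being restrictions; dropping
  the maps removes the ambiguity of their extensions to the ambient space.\<close>

definition surj_subspaces ::
  "('v,'e) pre_digraph \<Rightarrow> ('v,'e,'k::field) representation \<Rightarrow> ('v \<Rightarrow> 'k vect set) \<Rightarrow> bool" where
  "surj_subspaces Q \<phi> E \<longleftrightarrow>
     (\<forall>x\<in>verts Q. vect.subspace (E x) \<and> E x \<subseteq> vsp \<phi> x) \<and>
     (\<forall>a\<in>arcs Q. amap \<phi> a ` E (tail Q a) = E (head Q a))"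

text \<open>In the equivalence, one direction says that \<open>N\<close> is a subrepresentation, the
  other that the induced map on the quotient by \<open>N\<close> is injective.\<close>

definition inj_kernel ::
  "('v,'e) pre_digraph \<Rightarrow> ('v,'e,'k::field) representation \<Rightarrow> ('v \<Rightarrow> 'k vect set) \<Rightarrow> bool" where
  "inj_kernel Q \<phi> N \<longleftrightarrow>
     (\<forall>x\<in>verts Q. vect.subspace (N x) \<and> N x \<subseteq> vsp \<phi> x) \<and>
     (\<forall>a\<in>arcs Q. \<forall>v\<in>vsp \<phi> (tail Q a). amap \<phi> a v \<in> N (head Q a) \<longleftrightarrow> v \<in> N (tail Q a))"

lemma surj_subspaces_of_subrep:
  assumes a: "subrep Q \<phi> \<psi>" "all_surj Q \<psi>"
  shows "surj_subspaces Q \<phi> (vsp \<psi>)"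
proof -
  have \<psi>: "\<psi> \<in> rep Q" using a(1) unfolding subrep_def by blast
  have "amap \<phi> a ` vsp \<psi> (tail Q a) = vsp \<psi> (head Q a)" if "a \<in> arcs Q" for a
  proof -
    have "amap \<phi> a ` vsp \<psi> (tail Q a) = amap \<psi> a ` vsp \<psi> (tail Q a)"
      using a that unfolding subrep_def by (intro image_cong) simp_all
    then show ?thesis using a that unfolding all_surj_def by simp
  qed
  then show "surj_subspaces Q \<phi> (vsp \<psi>)"
    using a repD(2)[OF \<psi>] unfolding surj_subspaces_def subrep_def by simp
qed

lemma subrep_of_surj_subspaces:
  assumes \<phi>: "\<phi> \<in> rep Q" and E: "surj_subspaces Q \<phi> E"
  shows "subrep Q \<phi> \<lparr>vsp = E, amap = amap \<phi>\<rparr>" "all_surj Q \<lparr>vsp = E, amap = amap \<phi>\<rparr>"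
proof -
  have "fd_subspace (E x)" if "x \<in> verts Q" for x
    using E that repD(1)[OF \<phi> that] unfolding surj_subspaces_def by (blast intro: fd_subspace_subset)
  moreover have "amap \<phi> a ` E (tail Q a) \<subseteq> E (head Q a)" if "a \<in> arcs Q" for a
    using E that unfolding surj_subspaces_def by simp
  ultimately show "subrep Q \<phi> \<lparr>vsp = E, amap = amap \<phi>\<rparr>"
    using E repD(3)[OF \<phi>] unfolding surj_subspaces_def subrep_def rep_def linear_map_def by simp
  show "all_surj Q \<lparr>vsp = E, amap = amap \<phi>\<rparr>"
    using E unfolding surj_subspaces_def all_surj_def by simp
qed

text \<open>\<open>subrep\<close> leaves open the spaces at other vertices and the maps outside the
  given spaces, so a largest subrepresentation is unique only in the sense of the second
  conclusion.\<close>

lemma largest_surj_subrep_vsp: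
  assumes \<phi>: "\<phi> \<in> rep Q" and E: "surj_subspaces Q \<phi> E"
    and max: "\<forall>E'. surj_subspaces Q \<phi> E' \<longrightarrow> (\<forall>x\<in>verts Q. E' x \<subseteq> E x)"
  shows "largest_surj_subrep Q \<phi> \<lparr>vsp = E, amap = amap \<phi>\<rparr>"
    and "largest_surj_subrep Q \<phi> \<psi> \<Longrightarrow> x \<in> verts Q \<Longrightarrow> vsp \<psi> x = E x"
proof -
  let ?E = "\<lparr>vsp = E, amap = amap \<phi>\<rparr>"
  have "subrep Q ?E E'" if "subrep Q \<phi> E'" "all_surj Q E'" for E'
  proof -
    have "surj_subspaces Q \<phi> (vsp E')" using that by (rule surj_subspaces_of_subrep)
    then show ?thesis using that(1) max unfolding subrep_def by simp
  qed
  then show "largest_surj_subrep Q \<phi> ?E"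
    using subrep_of_surj_subspaces[OF \<phi> E] unfolding largest_surj_subrep_def by blast
  assume \<psi>: "largest_surj_subrep Q \<phi> \<psi>" and x: "x \<in> verts Q"
  then have "surj_subspaces Q \<phi> (vsp \<psi>)"
    unfolding largest_surj_subrep_def by (intro surj_subspaces_of_subrep) simp_all
  then have "vsp \<psi> x \<subseteq> E x" using max x by blast
  moreover have "subrep Q \<psi> ?E"
    using \<psi> subrep_of_surj_subspaces[OF \<phi> E] unfolding largest_surj_subrep_def by blast
  then have "E x \<subseteq> vsp \<psi> x" using x unfolding subrep_def by simp
  ultimately show "vsp \<psi> x = E x" by (rule subset_antisym)
qed

text \<open>Since \<open>p\<close> commutes with the arrows, applying \<open>p\<close> after an
  arrow of \<phi> is the same as applying the arrow of \<open>M\<close> to \<open>p v\<close>, and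
  an injective linear map vanishes only at 0.\<close>

lemma inj_kernel_of_quotient:
  assumes Q: "quiver Q" and \<phi>: "\<phi> \<in> rep Q"
    and p: "quotient_rep Q \<phi> M p" and M: "all_inj Q M"
  shows "inj_kernel Q \<phi> (\<lambda>x. {v \<in> vsp \<phi> x. p x v = 0})"
  unfolding inj_kernel_def
proof (intro conjI ballI)
  have Mr: "M \<in> rep Q" and h: "rep_hom Q \<phi> M p"
    using p unfolding quotient_rep_def by blast+
  have lin: "Vector_Spaces.linear vscale vscale (p x)" if "x \<in> verts Q" for x
    using h that unfolding rep_hom_def linear_map_def by blast
  show "vect.subspace {v \<in> vsp \<phi> x. p x v = 0}" if x: "x \<in> verts Q" for x
  proof -
    interpret p: Vector_Spaces.linear vscale vscale "p x" using lin[OF x] .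
    show ?thesis
      using vect.subspace_inter[OF repD(2)[OF \<phi> x] p.subspace_kernel] by (simp add: Int_def)
  qed
  show "{v \<in> vsp \<phi> x. p x v = 0} \<subseteq> vsp \<phi> x" for x by blast
  fix a v assume a: "a \<in> arcs Q" and v: "v \<in> vsp \<phi> (tail Q a)"
  interpret Ma: Vector_Spaces.linear vscale vscale "amap M a" using repD(3)[OF Mr a] .
  interpret pt: Vector_Spaces.linear vscale vscale "p (tail Q a)"
    using lin[OF quiverD(4)[OF Q a]] .
  have c: "p (head Q a) (amap \<phi> a v) = amap M a (p (tail Q a) v)"
    using h a v unfolding rep_hom_def by simp
  have pv: "p (tail Q a) v \<in> vsp M (tail Q a)"
    using h v quiverD(4)[OF Q a] unfolding rep_hom_def linear_map_def by blast
  have "inj_on (amap M a) (vsp M (tail Q a))" using M a unfolding all_inj_def by blast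
  then have "amap M a (p (tail Q a) v) = amap M a 0 \<longleftrightarrow> p (tail Q a) v = 0"
    using pv vect.subspace_0[OF repD(2)[OF Mr quiverD(4)[OF Q a]]] by (rule inj_on_eq_iff)
  then have "p (head Q a) (amap \<phi> a v) = 0 \<longleftrightarrow> p (tail Q a) v = 0"
    by (simp only: c Ma.zero)
  then show "amap \<phi> a v \<in> {v \<in> vsp \<phi> (head Q a). p (head Q a) v = 0} \<longleftrightarrow>
      v \<in> {v \<in> vsp \<phi> (tail Q a). p (tail Q a) v = 0}"
    using v repD(4)[OF \<phi> a v] by simp
qed

text \<open>The quotient by \<open>N\<close> is realised on a complement of \<open>N\<close>, as the image of a projection.\<close>

lemma largest_inj_quotient_exists:
  assumes Q: "quiver Q" and \<phi>: "\<phi> \<in> rep Q" and N: "inj_kernel Q \<phi> N"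
    and min: "\<forall>N'. inj_kernel Q \<phi> N' \<longrightarrow> (\<forall>x\<in>verts Q. N x \<subseteq> N' x)"
  shows "\<exists>M p. largest_inj_quotient Q \<phi> M p \<and> (\<forall>x\<in>verts Q. \<forall>v. p x v = 0 \<longleftrightarrow> v \<in> N x)"
proof -
  have "\<forall>x\<in>verts Q. \<exists>p. Vector_Spaces.linear vscale vscale p \<and> (\<forall>v. p v = 0 \<longleftrightarrow> v \<in> N x) \<and>
      (\<forall>v. v - p v \<in> N x)"
  proof
    fix x assume "x \<in> verts Q"
    then have "vect.subspace (N x)" using N unfolding inj_kernel_def by blast
    then obtain p where "Vector_Spaces.linear vscale vscale p" "\<And>v. p v = 0 \<longleftrightarrow> v \<in> N x"
        "\<And>v. v - p v \<in> N x"
      by (rule projection_along_subspace) (rule that)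
    then show "\<exists>p. Vector_Spaces.linear vscale vscale p \<and> (\<forall>v. p v = 0 \<longleftrightarrow> v \<in> N x) \<and>
      (\<forall>v. v - p v \<in> N x)"
      by (intro exI[of _ p] conjI allI)
  qed
  then obtain p where p: "\<And>x. x \<in> verts Q \<Longrightarrow> Vector_Spaces.linear vscale vscale (p x)"
      "\<And>x v. x \<in> verts Q \<Longrightarrow> p x v = 0 \<longleftrightarrow> v \<in> N x"
      "\<And>x v. x \<in> verts Q \<Longrightarrow> v - p x v \<in> N x"
    unfolding bchoice_iff by blast
  have NV: "v \<in> N x \<Longrightarrow> v \<in> vsp \<phi> x" if "x \<in> verts Q" for x v
    using N that unfolding inj_kernel_def by blast
  have Na: "amap \<phi> a v \<in> N (head Q a) \<longleftrightarrow> v \<in> N (tail Q a)"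
    if "a \<in> arcs Q" "v \<in> vsp \<phi> (tail Q a)" for a v
    using N that unfolding inj_kernel_def by blast
  \<comment> \<open>\<open>p x v\<close> is \<open>v\<close> minus \<open>v - p x v\<close>, and the
    latter lies in \<open>N x\<close>, hence in the space at \<open>x\<close>. So the complement is
    found inside that space.\<close>
  have pV: "p x v \<in> vsp \<phi> x" if "x \<in> verts Q" "v \<in> vsp \<phi> x" for x v
    using vect.subspace_diff[OF repD(2)[OF \<phi> that(1)] that(2) NV[OF that(1) p(3)[OF that(1), of v]]]
    by (simp only: diff_diff_eq2 add_diff_cancel_left')
  define M where "M = \<lparr>vsp = (\<lambda>x. p x ` vsp \<phi> x), amap = (\<lambda>a. p (head Q a) \<circ> amap \<phi> a)\<rparr>"
  have lin: "Vector_Spaces.linear vscale vscale (p (head Q a) \<circ> amap \<phi> a)" if "a \<in> arcs Q" for a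
    using repD(3)[OF \<phi> that] p(1)[OF quiverD(5)[OF Q that]] by (rule Vector_Spaces.linear_compose)
  \<comment> \<open>\<open>v\<close> and its projection differ by an element of \<open>N\<close>,
    which the arrow maps into \<open>N\<close> and the projection at the head kills: the induced map
    does not depend on the representative.\<close>
  have comm: "p (head Q a) (amap \<phi> a (p (tail Q a) v)) = p (head Q a) (amap \<phi> a v)"
    if a: "a \<in> arcs Q" and v: "v \<in> vsp \<phi> (tail Q a)" for a v
  proof -
    let ?t = "tail Q a" let ?h = "head Q a"
    interpret ap: Vector_Spaces.linear vscale vscale "amap \<phi> a" using repD(3)[OF \<phi> a] .
    interpret ph: Vector_Spaces.linear vscale vscale "p ?h" using p(1)[OF quiverD(5)[OF Q a]] .
    have d: "v - p ?t v \<in> N ?t" by (rule p(3)[OF quiverD(4)[OF Q a]])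
    then have "amap \<phi> a (v - p ?t v) \<in> N ?h"
      using Na[OF a NV[OF quiverD(4)[OF Q a] d]] by blast
    then have "p ?h (amap \<phi> a (v - p ?t v)) = 0" using p(2)[OF quiverD(5)[OF Q a]] by blast
    then have "p ?h (amap \<phi> a v) - p ?h (amap \<phi> a (p ?t v)) = 0"
      by (simp only: ap.diff ph.diff)
    then show ?thesis by (simp only: right_minus_eq)
  qed
  have Mr: "M \<in> rep Q"
    unfolding rep_def linear_map_def M_def
  proof (intro CollectI conjI ballI)
    fix x assume x: "x \<in> verts Q"
    interpret px: Vector_Spaces.linear vscale vscale "p x" using p(1)[OF x] .
    obtain W where "finite W" "vsp \<phi> x = vect.span W"
      using repD(1)[OF \<phi> x] unfolding fd_subspace_def by blast
    then have "finite (p x ` W)" "p x ` vsp \<phi> x = vect.span (p x ` W)"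
      by (simp_all only: px.span_image finite_imageI)
    then have "fd_subspace (p x ` vsp \<phi> x)" unfolding fd_subspace_def by (metis vect.subspace_span)
    then show "fd_subspace (vsp \<lparr>vsp = (\<lambda>x. p x ` vsp \<phi> x), amap = (\<lambda>a. p (head Q a) \<circ> amap \<phi> a)\<rparr> x)"
      by simp
  next
    fix a assume a: "a \<in> arcs Q"
    show "Vector_Spaces.linear vscale vscale
        (amap \<lparr>vsp = (\<lambda>x. p x ` vsp \<phi> x), amap = (\<lambda>a. p (head Q a) \<circ> amap \<phi> a)\<rparr> a)"
      using lin[OF a] by simp
    show "amap \<lparr>vsp = (\<lambda>x. p x ` vsp \<phi> x), amap = (\<lambda>a. p (head Q a) \<circ> amap \<phi> a)\<rparr> a `
        vsp \<lparr>vsp = (\<lambda>x. p x ` vsp \<phi> x), amap = (\<lambda>a. p (head Q a) \<circ> amap \<phi> a)\<rparr> (tail Q a)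
        \<subseteq> vsp \<lparr>vsp = (\<lambda>x. p x ` vsp \<phi> x), amap = (\<lambda>a. p (head Q a) \<circ> amap \<phi> a)\<rparr> (head Q a)"
      using comm[OF a] repD(4)[OF \<phi> a] by auto
  qed
  have hom: "rep_hom Q \<phi> M p"
    unfolding rep_hom_def linear_map_def M_def using p(1) comm by simp
  have quot: "quotient_rep Q \<phi> M p"
    unfolding quotient_rep_def using Mr hom by (simp add: M_def)
  have inj: "all_inj Q M"
    unfolding all_inj_def
  proof
    fix a assume a: "a \<in> arcs Q"
    let ?t = "tail Q a" let ?h = "head Q a"
    interpret f: Vector_Spaces.linear vscale vscale "p ?h \<circ> amap \<phi> a" using lin[OF a] .
    interpret pt: Vector_Spaces.linear vscale vscale "p ?t" using p(1)[OF quiverD(4)[OF Q a]] .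
    have "inj_on (p ?h \<circ> amap \<phi> a) (p ?t ` vsp \<phi> ?t)"
    proof (rule inj_onI)
      fix u' v' assume u': "u' \<in> p ?t ` vsp \<phi> ?t" and v': "v' \<in> p ?t ` vsp \<phi> ?t"
        and eq: "(p ?h \<circ> amap \<phi> a) u' = (p ?h \<circ> amap \<phi> a) v'"
      obtain u v where u: "u \<in> vsp \<phi> ?t" "u' = p ?t u" and v: "v \<in> vsp \<phi> ?t" "v' = p ?t v"
        using u' v' by blast
      have "(p ?h \<circ> amap \<phi> a) u = (p ?h \<circ> amap \<phi> a) v"
        using eq comm[OF a u(1)] comm[OF a v(1)] unfolding u(2) v(2) by (simp only: o_apply)
      then have "(p ?h \<circ> amap \<phi> a) (u - v) = 0" by (simp only: f.diff diff_self)
      then have "amap \<phi> a (u - v) \<in> N ?h" using p(2)[OF quiverD(5)[OF Q a]] by (simp only: o_apply)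
      moreover have "u - v \<in> vsp \<phi> ?t"
        by (rule vect.subspace_diff[OF repD(2)[OF \<phi> quiverD(4)[OF Q a]] u(1) v(1)])
      ultimately have "u - v \<in> N ?t" using Na[OF a] by blast
      then have "p ?t (u - v) = 0" using p(2)[OF quiverD(4)[OF Q a]] by blast
      then show "u' = v'" unfolding u(2) v(2) by (simp only: pt.diff right_minus_eq)
    qed
    then show "inj_on (amap M a) (vsp M ?t)" by (simp add: M_def)
  qed
  have "\<exists>h. rep_hom Q M M' h \<and> (\<forall>x\<in>verts Q. \<forall>v\<in>vsp \<phi> x. p' x v = h x (p x v))"
    if M': "quotient_rep Q \<phi> M' p'" "all_inj Q M'" for M' p'
  proof (intro exI conjI ballI)
    have hom': "rep_hom Q \<phi> M' p'" using M'(1) unfolding quotient_rep_def by blast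
    have lin': "Vector_Spaces.linear vscale vscale (p' x)" if "x \<in> verts Q" for x
      using hom' that unfolding rep_hom_def linear_map_def by blast
    \<comment> \<open>The factoring morphism is \<open>p'\<close> itself: by minimality of
      \<open>N\<close> its kernel contains \<open>N\<close>, so it takes the same value at
      \<open>v\<close> and at \<open>p x v\<close>.\<close>
    show eq: "p' x v = p' x (p x v)" if x: "x \<in> verts Q" and v: "v \<in> vsp \<phi> x" for x v
    proof -
      interpret p': Vector_Spaces.linear vscale vscale "p' x" using lin'[OF x] .
      have "N x \<subseteq> {v \<in> vsp \<phi> x. p' x v = 0}"
        by (rule min[rule_format, OF inj_kernel_of_quotient[OF Q \<phi> M'] x])
      then have "p' x (v - p x v) = 0" using p(3)[OF x] by blast
      then show ?thesis by (simp only: p'.diff right_minus_eq)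
    qed
    show "rep_hom Q M M' p'"
      unfolding rep_hom_def
    proof (intro conjI ballI)
      fix x assume x: "x \<in> verts Q"
      have "p' x ` vsp \<phi> x \<subseteq> vsp M' x"
        using hom' x unfolding rep_hom_def linear_map_def by blast
      then have "p' x ` vsp M x \<subseteq> vsp M' x" using pV[OF x] by (auto simp: M_def)
      then show "linear_map (vsp M x) (vsp M' x) (p' x)"
        unfolding linear_map_def using lin'[OF x] by blast
    next
      fix a v assume a: "a \<in> arcs Q" and v: "v \<in> vsp M (tail Q a)"
      have v': "v \<in> vsp \<phi> (tail Q a)" using v pV[OF quiverD(4)[OF Q a]] by (auto simp: M_def)
      have "p' (head Q a) (amap M a v) = p' (head Q a) (p (head Q a) (amap \<phi> a v))"
        by (simp add: M_def)
      also have "\<dots> = p' (head Q a) (amap \<phi> a v)"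
        by (rule eq[OF quiverD(5)[OF Q a] repD(4)[OF \<phi> a v'], symmetric])
      also have "\<dots> = amap M' a (p' (tail Q a) v)"
        using hom' a v' unfolding rep_hom_def by blast
      finally show "p' (head Q a) (amap M a v) = amap M' a (p' (tail Q a) v)" .
    qed
  qed
  then have "largest_inj_quotient Q \<phi> M p"
    unfolding largest_inj_quotient_def using quot inj by blast
  then show ?thesis using p(2) by blast
qed

text \<open>\<open>global_rank\<close> is a definite description, so the number must depend neither
  on the largest objects chosen nor on the vertex. The kernel of any largest injective quotient is
  \<open>N\<close>, which settles the former. For the latter, an arrow of the quotient maps the
  image of \<open>E\<close> at its tail isomorphically onto the one at its head.\<close>

lemma global_rank_eq:
  assumes Q: "quiver Q" and \<phi>: "\<phi> \<in> rep Q" and E: "surj_subspaces Q \<phi> E"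
    and max: "\<forall>E'. surj_subspaces Q \<phi> E' \<longrightarrow> (\<forall>x\<in>verts Q. E' x \<subseteq> E x)"
    and N: "inj_kernel Q \<phi> N"
    and min: "\<forall>N'. inj_kernel Q \<phi> N' \<longrightarrow> (\<forall>x\<in>verts Q. N x \<subseteq> N' x)"
    and x: "x \<in> verts Q"
  shows "global_rank Q \<phi> = vect.dim (E x) - vect.dim (E x \<inter> N x)"
proof -
  let ?n = "\<lambda>y. vect.dim (E y) - vect.dim (E y \<inter> N y)"
  obtain M0 p0 where M0: "largest_inj_quotient Q \<phi> M0 p0"
      and p0: "\<And>x v. x \<in> verts Q \<Longrightarrow> p0 x v = 0 \<longleftrightarrow> v \<in> N x"
    using largest_inj_quotient_exists[OF Q \<phi> N min] by blast
  have EV: "E y \<subseteq> vsp \<phi> y" "vect.subspace (E y)" "fd_subspace (E y)" if "y \<in> verts Q" for y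
    using E that repD(1)[OF \<phi> that] unfolding surj_subspaces_def by (blast intro: fd_subspace_subset)+
  have dim: "vect.dim (p y ` vsp \<psi> y) = ?n y"
    if \<psi>: "largest_surj_subrep Q \<phi> \<psi>" and M: "largest_inj_quotient Q \<phi> M p" and y: "y \<in> verts Q"
    for \<psi> M p y
  proof -
    have q: "quotient_rep Q \<phi> M p" "all_inj Q M"
      using M unfolding largest_inj_quotient_def by blast+
    have lin: "Vector_Spaces.linear vscale vscale (p y)"
      using q(1) y unfolding quotient_rep_def rep_hom_def linear_map_def by blast
    have "{v \<in> E y. p y v = 0} = E y \<inter> N y"
    proof -
      have "N y \<subseteq> {v \<in> vsp \<phi> y. p y v = 0}"
        by (rule min[rule_format, OF inj_kernel_of_quotient[OF Q \<phi> q] y])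
      \<comment> \<open>\<open>p0\<close> has kernel \<open>N\<close>, and maximality of
        \<open>p\<close> makes \<open>p0\<close> factor through \<open>p\<close>; so the kernel of
        \<open>p\<close> is no larger than \<open>N\<close>.\<close>
      moreover have "v \<in> N y" if v: "v \<in> vsp \<phi> y" "p y v = 0" for v
      proof -
        have "quotient_rep Q \<phi> M0 p0 \<and> all_inj Q M0"
          using M0 unfolding largest_inj_quotient_def by blast
        then obtain h where h: "rep_hom Q M M0 h"
            "\<forall>x\<in>verts Q. \<forall>v\<in>vsp \<phi> x. p0 x v = h x (p x v)"
          using M unfolding largest_inj_quotient_def by blast
        then interpret h: Vector_Spaces.linear vscale vscale "h y"
          using y unfolding rep_hom_def linear_map_def by blast
        have "p0 y v = h y 0" using h(2) y v by (metis)
        then show ?thesis using p0[OF y] by (simp only: h.zero)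
      qed
      ultimately show ?thesis using EV(1)[OF y] by blast
    qed
    moreover obtain W where "finite W" "E y = vect.span W"
      using EV(3)[OF y] unfolding fd_subspace_def by blast
    then have "vect.dim (E y) = vect.dim {v \<in> E y. p y v = 0} + vect.dim (p y ` E y)"
      using EV(2)[OF y] lin by (intro vect_dim_kernel_plus_image[of _ W]) simp_all
    ultimately show ?thesis
      using largest_surj_subrep_vsp(2)[OF \<phi> E max \<psi> y] by simp
  qed
  let ?E = "\<lparr>vsp = E, amap = amap \<phi>\<rparr>"
  have lE: "largest_surj_subrep Q \<phi> ?E" by (rule largest_surj_subrep_vsp(1)[OF \<phi> E max])
  have q0: "M0 \<in> rep Q" "rep_hom Q \<phi> M0 p0" "all_inj Q M0"
    using M0 unfolding largest_inj_quotient_def quotient_rep_def by blast+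
  have "?n (tail Q a) = ?n (head Q a)" if a: "a \<in> arcs Q" for a
  proof -
    let ?t = "tail Q a" let ?h = "head Q a"
    let ?S = "p0 ?t ` E ?t"
    have t: "?t \<in> verts Q" and h: "?h \<in> verts Q" using quiverD(4,5)[OF Q a] .
    interpret f: Vector_Spaces.linear vscale vscale "amap M0 a" using repD(3)[OF q0(1) a] .
    interpret pt: Vector_Spaces.linear vscale vscale "p0 ?t"
      using q0(2) t unfolding rep_hom_def linear_map_def by blast
    have sub: "?S \<subseteq> vsp M0 ?t"
      using q0(2) t EV(1)[OF t] unfolding rep_hom_def linear_map_def by blast
    have S: "vect.subspace ?S" by (rule pt.subspace_image[OF EV(2)[OF t]])
    have "amap M0 a ` ?S = p0 ?h ` amap \<phi> a ` E ?t"
      unfolding image_image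
      using q0(2) a EV(1)[OF t] unfolding rep_hom_def by (intro image_cong) auto
    also have "amap \<phi> a ` E ?t = E ?h" using E a unfolding surj_subspaces_def by blast
    finally have img: "amap M0 a ` ?S = p0 ?h ` E ?h" .
    have "v = 0" if "v \<in> ?S" "amap M0 a v = 0" for v
    proof -
      have "inj_on (amap M0 a) (vsp M0 ?t)" using q0(3) a unfolding all_inj_def by blast
      moreover have "amap M0 a v = amap M0 a 0" using that(2) by (simp only: f.zero)
      moreover have "0 \<in> vsp M0 ?t" by (rule vect.subspace_0[OF repD(2)[OF q0(1) t]])
      ultimately show ?thesis using that(1) sub by (meson inj_onD subsetD)
    qed
    then have ker: "{v \<in> ?S. amap M0 a v = 0} \<subseteq> vect.span {}" by auto
    obtain W where "finite W" "vsp M0 ?t = vect.span W"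
      using repD(1)[OF q0(1) t] unfolding fd_subspace_def by blast
    then have "vect.dim ?S = vect.dim {v \<in> ?S. amap M0 a v = 0} + vect.dim (amap M0 a ` ?S)"
      using S sub f.linear_axioms by (intro vect_dim_kernel_plus_image[of _ W]) simp_all
    moreover have "vect.dim {v \<in> ?S. amap M0 a v = 0} = 0"
      using vect.dim_le_card[OF ker] by simp
    ultimately have "vect.dim ?S = vect.dim (p0 ?h ` E ?h)" using img by simp
    then show ?thesis using dim[OF lE M0 t] dim[OF lE M0 h] by simp
  qed
  then have const: "?n y = ?n x" if "y \<in> verts Q" for y
    using quiver_constant_on_verts[OF Q, of ?n y x] that x by blast
  show ?thesis
    unfolding global_rank_def
  proof (rule the_equality)
    show "\<exists>\<psi> M p. largest_surj_subrep Q \<phi> \<psi> \<and> largest_inj_quotient Q \<phi> M p \<and>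
        (\<forall>y\<in>verts Q. vect.dim (p y ` vsp \<psi> y) = ?n x)"
      using lE M0 dim[OF lE M0] const by (intro exI[of _ ?E] exI[of _ M0] exI[of _ p0]) simp
    fix n assume "\<exists>\<psi> M p. largest_surj_subrep Q \<phi> \<psi> \<and> largest_inj_quotient Q \<phi> M p \<and>
        (\<forall>y\<in>verts Q. vect.dim (p y ` vsp \<psi> y) = n)"
    then show "n = ?n x" using dim x by metis
  qed
qed

section \<open>Constructibility of the global rank\<close>

lemma dim_sum_less:
  assumes "finite X" "\<And>x. x \<in> X \<Longrightarrow> vect.subspace (F x)" "\<And>x. x \<in> X \<Longrightarrow> F x \<subseteq> G x"
    and "\<And>x. x \<in> X \<Longrightarrow> fd_subspace (G x)" and ne: "\<exists>x\<in>X. F x \<noteq> G x"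
  shows "(\<Sum>x\<in>X. vect.dim (F x)) < (\<Sum>x\<in>X. vect.dim (G x))"
proof -
  have W: "\<exists>W. finite W \<and> G x \<subseteq> vect.span W" if "x \<in> X" for x
    using assms(4)[OF that] unfolding fd_subspace_def by blast
  have "vect.dim (F x) \<le> vect.dim (G x)" if x: "x \<in> X" for x
    using W[OF x] vect.dim_mono_finite[OF assms(3)[OF x]] by blast
  moreover have "\<exists>x\<in>X. vect.dim (F x) < vect.dim (G x)"
  proof -
    obtain x where x: "x \<in> X" "F x \<noteq> G x" using ne by blast
    have "\<not> vect.dim (G x) \<le> vect.dim (F x)"
      using W[OF x(1)] x(2) vect.subspace_eq_if_dim_le[OF assms(2,3)[OF x(1)]] by blast
    then show ?thesis using x(1) by (intro bexI[of _ x]) simp_all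
  qed
  ultimately show ?thesis using assms(1) by (intro sum_strict_mono_ex1) simp_all
qed

text \<open>The total dimension changes strictly at every nonstationary step and stays between 0 and
  \<open>B\<close>, so one of the steps 0 to \<open>B\<close> is stationary, and \<open>step\<close>
  propagates this. As \<open>B\<close> serves also as the stopping index, a dimension bound valid
  for all parameters gives one index for all of them.\<close>

lemma subspace_chain_stabilizes:
  fixes F :: "nat \<Rightarrow> 'v \<Rightarrow> 'k::field vect set"
  assumes fin: "finite X"
    and F: "\<And>k x. x \<in> X \<Longrightarrow> fd_subspace (F k x)"
    and bound: "\<And>k. (\<Sum>x\<in>X. vect.dim (F k x)) \<le> B"
    and mono: "(\<forall>k. \<forall>x\<in>X. F (Suc k) x \<subseteq> F k x) \<or> (\<forall>k. \<forall>x\<in>X. F k x \<subseteq> F (Suc k) x)"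
    and step: "\<And>k. \<forall>x\<in>X. F (Suc k) x = F k x \<Longrightarrow> \<forall>x\<in>X. F (Suc (Suc k)) x = F (Suc k) x"
  shows "\<forall>x\<in>X. F (Suc B) x = F B x"
proof -
  define d where "d k = (\<Sum>x\<in>X. vect.dim (F k x))" for k
  have sub: "vect.subspace (F k x)" if "x \<in> X" for k x
    using F[OF that] unfolding fd_subspace_def by blast
  have "\<exists>k\<le>B. \<forall>x\<in>X. F (Suc k) x = F k x"
  proof (rule ccontr)
    assume "\<not> ?thesis"
    then have ne: "\<exists>x\<in>X. F (Suc k) x \<noteq> F k x" if "k \<le> B" for k using that by blast
    from mono show False
    proof
      assume dec: "\<forall>k. \<forall>x\<in>X. F (Suc k) x \<subseteq> F k x"
      have less: "d (Suc k) < d k" if "k \<le> B" for k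
        unfolding d_def using dec ne[OF that] by (intro dim_sum_less fin sub F) blast+
      have "d k + k \<le> d 0" if "k \<le> Suc B" for k
        using that
      proof (induct k)
        case (Suc k)
        then show ?case using less[of k] by simp
      qed simp
      from this[of "Suc B"] show False using bound[of 0] unfolding d_def by simp
    next
      assume inc: "\<forall>k. \<forall>x\<in>X. F k x \<subseteq> F (Suc k) x"
      have less: "d k < d (Suc k)" if "k \<le> B" for k
      proof -
        have "\<exists>x\<in>X. F k x \<noteq> F (Suc k) x" using ne[OF that] by metis
        then show ?thesis
          unfolding d_def using inc by (intro dim_sum_less fin sub F) blast+
      qed
      have "k \<le> d k" if "k \<le> Suc B" for k
        using that
      proof (induct k)
        case (Suc k)
        then show ?case using less[of k] by simp
      qed simp
      from this[of "Suc B"] show False using bound[of "Suc B"] unfolding d_def by simp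
    qed
  qed
  then obtain k where k: "k \<le> B" "\<forall>x\<in>X. F (Suc k) x = F k x" by blast
  from k(1) show ?thesis
  proof (induct rule: dec_induct)
    case base
    show ?case by (rule k(2))
  next
    case (step n)
    from step(3) show ?case by (rule assms(5))
  qed
qed

section \<open>Iterations towards the largest subrepresentation and the smallest kernel\<close>

text \<open>At a fixed point the condition on incoming arrows gives surjectivity and the one on
  outgoing arrows gives closure under the maps. Both refer to the old spaces, so one step consists
  of images, preimages and intersections.\<close>

definition surj_step ::
  "('v,'e) pre_digraph \<Rightarrow> ('v,'e,'k::field) representation \<Rightarrow> ('v \<Rightarrow> 'k vect set) \<Rightarrow> 'v \<Rightarrow> 'k vect set" where
  "surj_step Q \<phi> V x = {v \<in> V x.
     (\<forall>a\<in>{a \<in> arcs Q. head Q a = x}. v \<in> amap \<phi> a ` V (tail Q a)) \<and>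
     (\<forall>a\<in>{a \<in> arcs Q. tail Q a = x}. amap \<phi> a v \<in> V (head Q a))}"

text \<open>Closing under images makes a fixed point a subrepresentation; closing under preimages
  makes the quotient by it injective. The span forms the sum of these subspaces.\<close>

definition kernel_step ::
  "('v,'e) pre_digraph \<Rightarrow> ('v,'e,'k::field) representation \<Rightarrow> ('v \<Rightarrow> 'k vect set) \<Rightarrow> 'v \<Rightarrow> 'k vect set" where
  "kernel_step Q \<phi> V x = vect.span (V x \<union>
     (\<Union>a\<in>{a \<in> arcs Q. head Q a = x}. amap \<phi> a ` V (tail Q a)) \<union>
     (\<Union>a\<in>{a \<in> arcs Q. tail Q a = x}. {v \<in> vsp \<phi> x. amap \<phi> a v \<in> V (head Q a)}))"

text \<open>Stationarity is known only at the vertices of \<open>Q\<close>, whereas the iterates are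
  functions on the whole vertex type; the congruence carries it over to the next iterate.\<close>

lemma surj_step_cong:
  assumes Q: "quiver Q" and eq: "\<forall>x\<in>verts Q. V x = V' x" and x: "x \<in> verts Q"
  shows "surj_step Q \<phi> V x = surj_step Q \<phi> V' x"
proof -
  have "V (tail Q a) = V' (tail Q a)" "V (head Q a) = V' (head Q a)" if "a \<in> arcs Q" for a
    using eq quiverD(4,5)[OF Q that] by blast+
  then show ?thesis unfolding surj_step_def using eq x by simp
qed

lemma kernel_step_cong:
  assumes Q: "quiver Q" and eq: "\<forall>x\<in>verts Q. V x = V' x" and x: "x \<in> verts Q"
  shows "kernel_step Q \<phi> V x = kernel_step Q \<phi> V' x"
proof -
  have "V (tail Q a) = V' (tail Q a)" "V (head Q a) = V' (head Q a)" if "a \<in> arcs Q" for a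
    using eq quiverD(4,5)[OF Q that] by blast+
  then show ?thesis unfolding kernel_step_def using eq x by simp
qed

lemma surj_subspaces_fixpoint:
  assumes Q: "quiver Q" and V: "\<And>x. x \<in> verts Q \<Longrightarrow> vect.subspace (V x)"
    "\<And>x. x \<in> verts Q \<Longrightarrow> V x \<subseteq> vsp \<phi> x"
    and fp: "\<forall>x\<in>verts Q. surj_step Q \<phi> V x = V x"
  shows "surj_subspaces Q \<phi> V"
proof -
  have "amap \<phi> a ` V (tail Q a) = V (head Q a)" if a: "a \<in> arcs Q" for a
  proof
    show "amap \<phi> a ` V (tail Q a) \<subseteq> V (head Q a)"
      using fp[rule_format, OF quiverD(4)[OF Q a]] a unfolding surj_step_def by blast
    show "V (head Q a) \<subseteq> amap \<phi> a ` V (tail Q a)"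
      using fp[rule_format, OF quiverD(5)[OF Q a]] a unfolding surj_step_def by blast
  qed
  then show ?thesis using V unfolding surj_subspaces_def by blast
qed

lemma surj_subspaces_subset_step:
  assumes Q: "quiver Q" and E: "surj_subspaces Q \<phi> E"
    and sub: "\<forall>x\<in>verts Q. E x \<subseteq> V x" and x: "x \<in> verts Q"
  shows "E x \<subseteq> surj_step Q \<phi> V x"
  unfolding surj_step_def
proof (intro subsetI CollectI conjI ballI)
  fix v assume v: "v \<in> E x"
  show "v \<in> V x" using v sub x by blast
  have Ea: "amap \<phi> a ` E (tail Q a) = E (head Q a)" if "a \<in> arcs Q" for a
    using E that unfolding surj_subspaces_def by blast
  show "v \<in> amap \<phi> a ` V (tail Q a)" if "a \<in> {a \<in> arcs Q. head Q a = x}" for a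
    using Ea[of a] sub quiverD(4)[OF Q, of a] that v by blast
  show "amap \<phi> a v \<in> V (head Q a)" if "a \<in> {a \<in> arcs Q. tail Q a = x}" for a
    using Ea[of a] sub quiverD(5)[OF Q, of a] that v by blast
qed

lemma inj_kernel_fixpoint:
  assumes Q: "quiver Q" and V: "\<And>x. x \<in> verts Q \<Longrightarrow> vect.subspace (V x)"
    "\<And>x. x \<in> verts Q \<Longrightarrow> V x \<subseteq> vsp \<phi> x"
    and fp: "\<forall>x\<in>verts Q. kernel_step Q \<phi> V x = V x"
  shows "inj_kernel Q \<phi> V"
proof -
  have sub: "V x \<union> (\<Union>a\<in>{a \<in> arcs Q. head Q a = x}. amap \<phi> a ` V (tail Q a)) \<union>
     (\<Union>a\<in>{a \<in> arcs Q. tail Q a = x}. {v \<in> vsp \<phi> x. amap \<phi> a v \<in> V (head Q a)}) \<subseteq> V x"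
    if "x \<in> verts Q" for x
    using fp[rule_format, OF that, THEN equalityD1] unfolding kernel_step_def
    by (rule order_trans[OF vect.span_superset])
  have "amap \<phi> a v \<in> V (head Q a) \<longleftrightarrow> v \<in> V (tail Q a)"
    if a: "a \<in> arcs Q" and v: "v \<in> vsp \<phi> (tail Q a)" for a v
    using sub[OF quiverD(4)[OF Q a]] sub[OF quiverD(5)[OF Q a]] a v by blast
  then show ?thesis using V unfolding inj_kernel_def by blast
qed

lemma kernel_step_subset:
  assumes Q: "quiver Q" and N: "inj_kernel Q \<phi> N"
    and sub: "\<forall>x\<in>verts Q. V x \<subseteq> N x" and x: "x \<in> verts Q"
  shows "kernel_step Q \<phi> V x \<subseteq> N x"
  unfolding kernel_step_def
proof (rule vect.span_minimal)
  have Na: "amap \<phi> a v \<in> N (head Q a) \<longleftrightarrow> v \<in> N (tail Q a)"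
    if "a \<in> arcs Q" "v \<in> vsp \<phi> (tail Q a)" for a v
    using N that unfolding inj_kernel_def by blast
  have NV: "N y \<subseteq> vsp \<phi> y" if "y \<in> verts Q" for y
    using N that unfolding inj_kernel_def by blast
  show "vect.subspace (N x)" using N x unfolding inj_kernel_def by blast
  have "amap \<phi> a v \<in> N (head Q a)" if a: "a \<in> arcs Q" and v: "v \<in> V (tail Q a)" for a v
    using Na[OF a] NV[OF quiverD(4)[OF Q a]] sub quiverD(4)[OF Q a] v by blast
  moreover have "v \<in> N (tail Q a)"
    if a: "a \<in> arcs Q" and v: "v \<in> vsp \<phi> (tail Q a)" "amap \<phi> a v \<in> V (head Q a)" for a v
    using Na[OF a v(1)] sub quiverD(5)[OF Q a] v by blast
  ultimately show "V x \<union> (\<Union>a\<in>{a \<in> arcs Q. head Q a = x}. amap \<phi> a ` V (tail Q a)) \<union>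
     (\<Union>a\<in>{a \<in> arcs Q. tail Q a = x}. {v \<in> vsp \<phi> x. amap \<phi> a v \<in> V (head Q a)}) \<subseteq> N x"
    using sub x by blast
qed

lemma inj_kernel_vsp:
  assumes "\<phi> \<in> rep Q"
  shows "inj_kernel Q \<phi> (vsp \<phi>)"
  unfolding inj_kernel_def using repD(2,4)[OF assms] by blast

section \<open>Families of representations and their global rank\<close>

context constructible_algebra
begin

lemma subspace_family_finite_Int:
  assumes "finite I" "subspace_family S" "\<And>i. i \<in> I \<Longrightarrow> subspace_family (T i)"
  shows "subspace_family (\<lambda>A. {v \<in> S A. \<forall>i\<in>I. v \<in> T i A})"
  using assms(1,3)
proof (induct rule: finite_induct)
  case empty
  then show ?case using assms(2) by simp
next
  case (insert i I)
  have "subspace_family (\<lambda>A. {v \<in> S A. \<forall>i\<in>I. v \<in> T i A} \<inter> T i A)"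
    by (intro subspace_family_Int insert) simp_all
  then show ?case by (rule subspace_family.equal) auto
qed

lemma subspace_family_span_Un:
  assumes "subspace_family (\<lambda>A. vect.span (S A))" "subspace_family (\<lambda>A. vect.span (T A))"
  shows "subspace_family (\<lambda>A. vect.span (S A \<union> T A))"
  unfolding vect.span_Un using assms by (rule subspace_family_plus)

lemma subspace_family_span:
  assumes "subspace_family S"
  shows "subspace_family (\<lambda>A. vect.span (S A))"
  using assms
  by (rule subspace_family.equal)
    (rule vect.span_eq_iff[THEN iffD2, OF subspace_family_subspace[OF assms], symmetric])

lemma subspace_family_span_UN:
  assumes "finite I" "\<And>i. i \<in> I \<Longrightarrow> subspace_family (S i)"
  shows "subspace_family (\<lambda>A. vect.span (\<Union>i\<in>I. S i A))"
  using assms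
proof (induct rule: finite_induct)
  case empty
  then show ?case using subspace_family_zero by simp
next
  case (insert i I)
  have "subspace_family (\<lambda>A. vect.span (S i A \<union> (\<Union>i\<in>I. S i A)))"
    by (intro subspace_family_span_Un subspace_family_span insert) simp_all
  then show ?case by simp
qed

text \<open>\<open>Q\<close> is not tied to the parameter space: along a sequence of functors the
  quiver, and even the types of its vertices and arrows, may change while \<open>R\<close> stays the
  same.\<close>

definition rep_family ::
  "('v,'e) pre_digraph \<Rightarrow> ('a \<Rightarrow> ('v,'e,'k) representation) \<Rightarrow> bool" where
  "rep_family Q \<Phi> \<longleftrightarrow> (\<forall>A\<in>R. \<Phi> A \<in> rep Q) \<and>
     (\<forall>x\<in>verts Q. subspace_family (\<lambda>A. vsp (\<Phi> A) x)) \<and>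
     (\<forall>a\<in>arcs Q. poly_map (\<lambda>A. amap (\<Phi> A) a))"

lemma rep_familyD:
  assumes "rep_family Q \<Phi>"
  shows "A \<in> R \<Longrightarrow> \<Phi> A \<in> rep Q" "x \<in> verts Q \<Longrightarrow> subspace_family (\<lambda>A. vsp (\<Phi> A) x)"
    "a \<in> arcs Q \<Longrightarrow> poly_map (\<lambda>A. amap (\<Phi> A) a)"
  using assms unfolding rep_family_def by blast+

lemma subspace_family_surj_step:
  assumes Q: "quiver Q" and \<Phi>: "rep_family Q \<Phi>"
    and V: "\<And>x. x \<in> verts Q \<Longrightarrow> subspace_family (\<lambda>A. V A x)" and x: "x \<in> verts Q"
  shows "subspace_family (\<lambda>A. surj_step Q (\<Phi> A) (V A) x)"
proof -
  have fin: "finite {a \<in> arcs Q. head Q a = x}" "finite {a \<in> arcs Q. tail Q a = x}"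
    using quiverD(2)[OF Q] by simp_all
  have 1: "subspace_family (\<lambda>A. amap (\<Phi> A) a ` V A (tail Q a))" if "a \<in> arcs Q" for a
    by (rule subspace_family_image[OF V[OF quiverD(4)[OF Q that]] rep_familyD(3)[OF \<Phi> that]])
  have 2: "subspace_family (\<lambda>A. {v \<in> V A x. amap (\<Phi> A) a v \<in> V A (head Q a)})"
    if "a \<in> arcs Q" for a
    by (rule subspace_family_preimage[OF V[OF x] V[OF quiverD(5)[OF Q that]] rep_familyD(3)[OF \<Phi> that]])
  have "subspace_family (\<lambda>A.
      {v \<in> V A x. \<forall>a\<in>{a \<in> arcs Q. head Q a = x}. v \<in> amap (\<Phi> A) a ` V A (tail Q a)} \<inter>
      {v \<in> V A x. \<forall>a\<in>{a \<in> arcs Q. tail Q a = x}. v \<in> {v \<in> V A x. amap (\<Phi> A) a v \<in> V A (head Q a)}})"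
    using 1 2 by (intro subspace_family_Int subspace_family_finite_Int fin V x) simp_all
  then show ?thesis by (rule subspace_family.equal) (auto simp: surj_step_def)
qed

lemma subspace_family_kernel_step:
  assumes Q: "quiver Q" and \<Phi>: "rep_family Q \<Phi>"
    and V: "\<And>x. x \<in> verts Q \<Longrightarrow> subspace_family (\<lambda>A. V A x)" and x: "x \<in> verts Q"
  shows "subspace_family (\<lambda>A. kernel_step Q (\<Phi> A) (V A) x)"
proof -
  have fin: "finite {a \<in> arcs Q. head Q a = x}" "finite {a \<in> arcs Q. tail Q a = x}"
    using quiverD(2)[OF Q] by simp_all
  have 1: "subspace_family (\<lambda>A. amap (\<Phi> A) a ` V A (tail Q a))" if "a \<in> arcs Q" for a
    by (rule subspace_family_image[OF V[OF quiverD(4)[OF Q that]] rep_familyD(3)[OF \<Phi> that]])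
  have 2: "subspace_family (\<lambda>A. {v \<in> vsp (\<Phi> A) x. amap (\<Phi> A) a v \<in> V A (head Q a)})"
    if "a \<in> arcs Q" for a
    by (rule subspace_family_preimage[OF rep_familyD(2)[OF \<Phi> x] V[OF quiverD(5)[OF Q that]]
          rep_familyD(3)[OF \<Phi> that]])
  show ?thesis
    unfolding kernel_step_def
    using 1 2 by (intro subspace_family_span_Un subspace_family_span_UN subspace_family_span fin V x)
      simp_all
qed

lemma constructible_fun_sum_dim:
  assumes "finite X" "\<And>x. x \<in> X \<Longrightarrow> subspace_family (\<lambda>A. V A x)"
  shows "constructible_fun (\<lambda>A. \<Sum>x\<in>X. vect.dim (V A x))"
  using assms
proof (induct rule: finite_induct)
  case empty
  then show ?case by (simp add: constructible_fun_const)
next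
  case (insert x X)
  have "constructible_fun (\<lambda>A. vect.dim (V A x) + (\<Sum>x\<in>X. vect.dim (V A x)))"
    by (rule constructible_fun_comp2[OF constructible_fun_dim[OF insert(4)] insert(3)[OF insert(4)]]) simp_all
  then show ?case using insert(1,2) by simp
qed

lemma constructible_global_rank:
  assumes Q: "quiver Q" and \<Phi>: "rep_family Q \<Phi>"
  shows "constructible_fun (\<lambda>A. global_rank Q (\<Phi> A))"
proof -
  define E where "E k A = (surj_step Q (\<Phi> A) ^^ k) (vsp (\<Phi> A))" for k A
  define N where "N k A = (kernel_step Q (\<Phi> A) ^^ k) (\<lambda>_. {0})" for k A
  have E_Suc: "E (Suc k) A = surj_step Q (\<Phi> A) (E k A)" for k A by (simp add: E_def)
  have N_Suc: "N (Suc k) A = kernel_step Q (\<Phi> A) (N k A)" for k A by (simp add: N_def)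
  have famE: "subspace_family (\<lambda>A. E k A x)" if "x \<in> verts Q" for k x
    using that
  proof (induct k arbitrary: x)
    case 0
    then show ?case using rep_familyD(2)[OF \<Phi>] by (simp add: E_def)
  next
    case (Suc k)
    show ?case unfolding E_Suc by (rule subspace_family_surj_step[OF Q \<Phi> Suc])
  qed
  have famN: "subspace_family (\<lambda>A. N k A x)" if "x \<in> verts Q" for k x
    using that
  proof (induct k arbitrary: x)
    case 0
    then show ?case using subspace_family_zero by (simp add: N_def)
  next
    case (Suc k)
    show ?case unfolding N_Suc by (rule subspace_family_kernel_step[OF Q \<Phi> Suc])
  qed
  have decE: "E (Suc k) A x \<subseteq> E k A x" for k A x
    unfolding E_Suc surj_step_def by blast
  have incN: "N k A x \<subseteq> N (Suc k) A x" for k A x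
    unfolding N_Suc kernel_step_def by (rule order_trans[OF _ vect.span_superset]) blast
  have EV: "E k A x \<subseteq> vsp (\<Phi> A) x" for k A x
  proof (induct k)
    case 0
    then show ?case by (simp add: E_def)
  next
    case (Suc k)
    then show ?case using decE by blast
  qed
  have N_min: "\<forall>x\<in>verts Q. N k A x \<subseteq> N' x" if "inj_kernel Q (\<Phi> A) N'" for k A N'
  proof (induct k)
    case 0
    have "0 \<in> N' x" if "x \<in> verts Q" for x
      using \<open>inj_kernel Q (\<Phi> A) N'\<close> that vect.subspace_0 unfolding inj_kernel_def by blast
    then show ?case by (simp add: N_def)
  next
    case (Suc k)
    show ?case
      unfolding N_Suc using kernel_step_subset[OF Q that Suc] by blast
  qed
  have E_max: "\<forall>x\<in>verts Q. E' x \<subseteq> E k A x" if "surj_subspaces Q (\<Phi> A) E'" for k A E'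
  proof (induct k)
    case 0
    then show ?case using that unfolding surj_subspaces_def by (simp add: E_def)
  next
    case (Suc k)
    show ?case
      unfolding E_Suc using surj_subspaces_subset_step[OF Q that Suc] by blast
  qed
  \<comment> \<open>The whole of \<open>\<Phi> A\<close> is the kernel of the zero quotient, so
    minimality keeps the iterates inside it.\<close>
  have NV: "\<forall>x\<in>verts Q. N k A x \<subseteq> vsp (\<Phi> A) x" if "A \<in> R" for k A
    by (rule N_min[OF inj_kernel_vsp[OF rep_familyD(1)[OF \<Phi> that]]])
  have "finite ((\<lambda>A. \<Sum>x\<in>verts Q. vect.dim (vsp (\<Phi> A) x)) ` R)"
    using constructible_fun_sum_dim[where V = "\<lambda>A. vsp (\<Phi> A)", OF quiverD(1)[OF Q] rep_familyD(2)[OF \<Phi>]]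
    unfolding constructible_fun_def by blast
  \<comment> \<open>The total dimension is a constructible function and so takes finitely many
    values; an upper bound of these serves all parameters at once.\<close>
  then obtain B where B: "\<And>A. A \<in> R \<Longrightarrow> (\<Sum>x\<in>verts Q. vect.dim (vsp (\<Phi> A) x)) \<le> B"
    unfolding finite_nat_set_iff_bounded_le by blast
  have bound: "(\<Sum>x\<in>verts Q. vect.dim (V x)) \<le> B"
    if A: "A \<in> R" and V: "\<forall>x\<in>verts Q. V x \<subseteq> vsp (\<Phi> A) x" for V A
  proof -
    have "vect.dim (V x) \<le> vect.dim (vsp (\<Phi> A) x)" if x: "x \<in> verts Q" for x
    proof -
      obtain W where W: "finite W" "vsp (\<Phi> A) x = vect.span W"
        using repD(1)[OF rep_familyD(1)[OF \<Phi> A] x] unfolding fd_subspace_def by blast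
      show ?thesis by (rule vect.dim_mono_finite[OF V[rule_format, OF x] equalityD1[OF W(2)] W(1)])
    qed
    then show ?thesis by (rule order_trans[OF sum_mono B[OF A]])
  qed
  obtain x where x: "x \<in> verts Q" using quiverD(3)[OF Q] by blast
  have "constructible_fun (\<lambda>A. vect.dim (E B A x) - vect.dim (E B A x \<inter> N B A x))"
    using constructible_fun_dim[OF famE[OF x]]
      constructible_fun_dim[OF subspace_family_Int[OF famE[OF x] famN[OF x]]]
    by (rule constructible_fun_comp2)
  then show ?thesis
  proof (rule constructible_fun_cong)
    fix A assume A: "A \<in> R"
    have \<phi>: "\<Phi> A \<in> rep Q" by (rule rep_familyD(1)[OF \<Phi> A])
    have "\<forall>x\<in>verts Q. E (Suc B) A x = E B A x"
    proof (rule subspace_chain_stabilizes[where F = "\<lambda>k. E k A"])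
      show "fd_subspace (E k A x)" if "x \<in> verts Q" for k x
        using famE[OF that] A by (rule subspace_family_fd)
      show "(\<Sum>x\<in>verts Q. vect.dim (E k A x)) \<le> B" for k
        using EV by (intro bound[OF A]) blast
      show "(\<forall>k. \<forall>x\<in>verts Q. E (Suc k) A x \<subseteq> E k A x) \<or>
          (\<forall>k. \<forall>x\<in>verts Q. E k A x \<subseteq> E (Suc k) A x)"
        using decE by blast
      show "\<forall>x\<in>verts Q. E (Suc (Suc k)) A x = E (Suc k) A x"
        if "\<forall>x\<in>verts Q. E (Suc k) A x = E k A x" for k
      proof
        fix x assume x: "x \<in> verts Q"
        show "E (Suc (Suc k)) A x = E (Suc k) A x"
          using surj_step_cong[OF Q that x, of "\<Phi> A"] by (simp only: E_Suc)
      qed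
    qed (rule quiverD(1)[OF Q])
    then have E: "surj_subspaces Q (\<Phi> A) (E B A)"
      unfolding E_Suc using EV subspace_family_subspace[OF famE A]
      by (intro surj_subspaces_fixpoint[OF Q]) simp_all
    have "\<forall>x\<in>verts Q. N (Suc B) A x = N B A x"
    proof (rule subspace_chain_stabilizes[where F = "\<lambda>k. N k A"])
      show "fd_subspace (N k A x)" if "x \<in> verts Q" for k x
        using famN[OF that] A by (rule subspace_family_fd)
      show "(\<Sum>x\<in>verts Q. vect.dim (N k A x)) \<le> B" for k
        by (rule bound[OF A NV[OF A]])
      show "(\<forall>k. \<forall>x\<in>verts Q. N (Suc k) A x \<subseteq> N k A x) \<or>
          (\<forall>k. \<forall>x\<in>verts Q. N k A x \<subseteq> N (Suc k) A x)"
        using incN by blast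
      show "\<forall>x\<in>verts Q. N (Suc (Suc k)) A x = N (Suc k) A x"
        if "\<forall>x\<in>verts Q. N (Suc k) A x = N k A x" for k
      proof
        fix x assume x: "x \<in> verts Q"
        show "N (Suc (Suc k)) A x = N (Suc k) A x"
          using kernel_step_cong[OF Q that x, of "\<Phi> A"] by (simp only: N_Suc)
      qed
    qed (rule quiverD(1)[OF Q])
    then have N: "inj_kernel Q (\<Phi> A) (N B A)"
      unfolding N_Suc using NV[OF A] subspace_family_subspace[OF famN A]
      by (intro inj_kernel_fixpoint[OF Q]) simp_all
    have "\<forall>E'. surj_subspaces Q (\<Phi> A) E' \<longrightarrow> (\<forall>x\<in>verts Q. E' x \<subseteq> E B A x)"
      using E_max by blast
    moreover have "\<forall>N'. inj_kernel Q (\<Phi> A) N' \<longrightarrow> (\<forall>x\<in>verts Q. N B A x \<subseteq> N' x)"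
      using N_min by blast
    ultimately show "vect.dim (E B A x) - vect.dim (E B A x \<inter> N B A x) = global_rank Q (\<Phi> A)"
      using global_rank_eq[OF Q \<phi> E _ N _ x] by simp
  qed
qed

end

section \<open>Rank functions and the representation space\<close>

lemma constructible_subset: "constructible X S \<Longrightarrow> S \<subseteq> topspace X"
  by (induct rule: constructible.induct) (auto dest: openin_subset closedin_subset)

lemma constructible_compl: "constructible X S \<Longrightarrow> constructible X (topspace X - S)"
proof (induct rule: constructible.induct)
  case (openin S)
  then show ?case by (intro constructible.closedin) (rule openin_closedin_eq[THEN iffD1, THEN conjunct2])
next
  case (closedin S)
  then show ?case by (intro constructible.openin) (simp add: closedin_def)
next
  case (Un S T)
  then show ?case by (simp add: Diff_Un constructible.Int)
next
  case (Int S T)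
  then show ?case by (simp add: Diff_Int constructible.Un)
qed

section \<open>Pullback and pushforward of families\<close>

lemma incl_linear: "Vector_Spaces.linear vscale vscale (incl Q y :: 'k::field vect \<Rightarrow> 'k vect)"
  by (rule vect_linearI; rule ext) (simp_all add: incl_def vscale_def split: prod.split)

lemma incl_zero: "incl Q y (0 :: 'k::field vect) = 0"
  by (rule ext) (simp add: incl_def split: prod.split)

lemma proj_linear: "Vector_Spaces.linear vscale vscale (proj Q y :: 'k::field vect \<Rightarrow> 'k vect)"
  by (rule vect_linearI; rule ext) (simp_all add: proj_def vscale_def)

lemma proj_sum_incl:
  fixes v :: "'v \<Rightarrow> 'k::field vect"
  assumes Q: "quiver Q" and Y: "Y \<subseteq> verts Q" and y: "y \<in> Y"
  shows "proj Q y (\<Sum>z\<in>Y. incl Q z (v z)) = v y"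
proof -
  interpret pr: Vector_Spaces.linear vscale vscale "proj Q y :: 'k vect \<Rightarrow> 'k vect"
    by (rule proj_linear)
  have "finite Y" using Y quiverD(1)[OF Q] by (rule finite_subset)
  have "proj Q y (\<Sum>z\<in>Y. incl Q z (v z)) = (\<Sum>z\<in>Y. proj Q y (incl Q z (v z)))"
    by (rule pr.sum)
  also have "\<dots> = (\<Sum>z\<in>Y. if y = z then v z else 0)"
    using Y y by (intro sum.cong refl proj_incl[OF Q]) blast+
  also have "\<dots> = v y" using \<open>finite Y\<close> y by simp
  finally show ?thesis .
qed

lemma pullback_in_rep:
  assumes f: "quiver_hom Q' Q f" and \<phi>: "\<phi> \<in> rep Q"
  shows "pullback f \<phi> \<in> rep Q'"
  unfolding rep_def
proof (intro CollectI conjI ballI)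
  show "fd_subspace (vsp (pullback f \<phi>) x)" if "x \<in> verts Q'" for x
    using f repD(1)[OF \<phi>] that by (simp add: pullback_def quiver_hom_def)
  fix a assume a: "a \<in> arcs Q'"
  then have fa: "snd f a \<in> arcs Q" "tail Q (snd f a) = fst f (tail Q' a)"
    "head Q (snd f a) = fst f (head Q' a)"
    using f by (simp_all add: quiver_hom_def)
  have "linear_map (vsp \<phi> (tail Q (snd f a))) (vsp \<phi> (head Q (snd f a))) (amap \<phi> (snd f a))"
    using \<phi> fa(1) unfolding rep_def by blast
  then show "linear_map (vsp (pullback f \<phi>) (tail Q' a)) (vsp (pullback f \<phi>) (head Q' a))
      (amap (pullback f \<phi>) a)"
    by (simp add: pullback_def fa)
qed

lemma incl_in_vsp_pushforward:
  assumes Q: "quiver Q" and \<phi>: "\<phi> \<in> rep Q" and y: "y \<in> verts Q" "fst f y = x" and v: "v \<in> vsp \<phi> y"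
  shows "incl Q y v \<in> vsp (pushforward Q f \<phi>) x"
proof -
  \<comment> \<open>A single summand is written as a sum over the whole fibre by choosing 0, which
    lies in every space, at the other vertices.\<close>
  let ?Y = "{y \<in> verts Q. fst f y = x}" and ?v = "\<lambda>z. if z = y then v else 0"
  have "(\<Sum>z\<in>?Y. incl Q z (?v z)) = (\<Sum>z\<in>?Y. if z = y then incl Q z v else 0)"
    by (intro sum.cong refl) (simp add: incl_zero)
  also have "\<dots> = incl Q y v" using y quiverD(1)[OF Q] by simp
  finally have "incl Q y v = (\<Sum>z\<in>?Y. incl Q z (?v z))" by (rule sym)
  moreover have "\<forall>z\<in>verts Q. ?v z \<in> vsp \<phi> z"
    using v vect.subspace_0[OF repD(2)[OF \<phi>]] by simp
  ultimately have "\<exists>v'. incl Q y v = (\<Sum>z\<in>?Y. incl Q z (v' z)) \<and> (\<forall>z\<in>verts Q. v' z \<in> vsp \<phi> z)"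
    by (intro exI[of _ ?v] conjI)
  then show ?thesis unfolding pushforward_def by simp
qed

context constructible_algebra
begin

lemma poly_map_comp:
  assumes "poly_map f" "poly_map g"
  shows "poly_map (\<lambda>A v. f A (g A v))"
  unfolding poly_map_def
proof (intro conjI ballI allI impI)
  show "poly_vec (\<lambda>A. f A (g A (w A)))" if "poly_vec w" for w
    by (rule poly_mapD(2)[OF assms(1) poly_mapD(2)[OF assms(2) that]])
  show "Vector_Spaces.linear vscale vscale (\<lambda>v. f A (g A v))" if "A \<in> R" for A
    using Vector_Spaces.linear_compose[OF poly_mapD(1)[OF assms(2) that] poly_mapD(1)[OF assms(1) that]]
    by (simp add: o_def)
qed

lemma poly_map_sum:
  assumes "finite I" "\<And>i. i \<in> I \<Longrightarrow> poly_map (f i)"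
  shows "poly_map (\<lambda>A v. \<Sum>i\<in>I. f i A v)"
  unfolding poly_map_def
proof (intro conjI ballI allI impI)
  show "poly_vec (\<lambda>A. \<Sum>i\<in>I. f i A (w A))" if "poly_vec w" for w
    by (rule poly_vec_sum[OF assms(1) poly_mapD(2)[OF assms(2) that]])
  show "Vector_Spaces.linear vscale vscale (\<lambda>v. \<Sum>i\<in>I. f i A v)" if "A \<in> R" for A
    using poly_mapD(1)[OF assms(2) that] by (intro vector_space_pair.linear_compose_sum[OF vect_pair]) blast
qed

lemma poly_map_incl: "poly_map (\<lambda>A. incl Q y)"
  unfolding poly_map_def
proof (intro conjI ballI allI impI)
  show "Vector_Spaces.linear vscale vscale (incl Q y :: 'k vect \<Rightarrow> 'k vect)" by (rule incl_linear)
  fix w :: "'a \<Rightarrow> 'k vect" assume w: "poly_vec w"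
  then obtain N where N: "\<forall>A\<in>R. \<forall>i\<ge>N. w A i = 0" unfolding poly_vec_def by blast
  let ?c = "to_nat_on (verts Q) y"
  \<comment> \<open>The sum is at least each of its terms, so \<open>?N\<close> lies beyond the code
    of every place that can carry a nonzero coordinate.\<close>
  let ?N = "Suc (\<Sum>i<N. prod_encode (?c, i))"
  have "incl Q y (w A) j = 0" if A: "A \<in> R" and j: "j \<ge> ?N" for A j
  proof -
    obtain m i where mi: "prod_decode j = (m, i)" by (cases "prod_decode j")
    then have je: "j = prod_encode (m, i)" by (metis prod_decode_inverse)
    have "N \<le> i" if "m = ?c"
    proof (rule ccontr)
      assume "\<not> N \<le> i"
      then have "prod_encode (?c, i) \<le> (\<Sum>i<N. prod_encode (?c, i))"
        by (intro member_le_sum) simp_all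
      then show False using j je that by simp
    qed
    then show ?thesis using N A mi by (simp add: incl_def)
  qed
  moreover have "(\<lambda>A. incl Q y (w A) j) \<in> P" for j
    using poly_vec_coord[OF w] P_const[of 0]
    by (cases "prod_decode j"; cases "fst (prod_decode j) = ?c") (simp_all add: incl_def)
  ultimately show "poly_vec (\<lambda>A. incl Q y (w A))" unfolding poly_vec_def by blast
qed

lemma poly_map_proj: "poly_map (\<lambda>A. proj Q y)"
  unfolding poly_map_def
proof (intro conjI ballI allI impI)
  show "Vector_Spaces.linear vscale vscale (proj Q y :: 'k vect \<Rightarrow> 'k vect)" by (rule proj_linear)
  fix w :: "'a \<Rightarrow> 'k vect" assume w: "poly_vec w"
  then obtain N where N: "\<forall>A\<in>R. \<forall>i\<ge>N. w A i = 0" unfolding poly_vec_def by blast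
  \<comment> \<open>The code of a pair is at least its second entry, so the bound \<open>N\<close>
    for \<open>w\<close> serves again.\<close>
  then have "\<forall>A\<in>R. \<forall>i\<ge>N. proj Q y (w A) i = 0"
    unfolding proj_def by (meson le_prod_encode_2 order_trans)
  moreover have "(\<lambda>A. proj Q y (w A) i) \<in> P" for i
    unfolding proj_def by (rule poly_vec_coord[OF w])
  ultimately show "poly_vec (\<lambda>A. proj Q y (w A))" unfolding poly_vec_def by blast
qed

text \<open>These are the spaces of a pushforward: \<open>Y\<close> is the fibre over a vertex,
  while the choice \<open>v\<close> is made on all of \<open>X\<close>, as in
  \<open>pushforward\<close>. Each element added to \<open>Y\<close> contributes the image of one
  more space.\<close>

lemma subspace_family_sum:
  assumes "finite Y" "Y \<subseteq> X" "\<And>y. y \<in> X \<Longrightarrow> subspace_family (S y)" "\<And>y. y \<in> Y \<Longrightarrow> poly_map (g y)"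
  shows "subspace_family (\<lambda>A. {(\<Sum>y\<in>Y. g y A (v y)) | v. \<forall>y\<in>X. v y \<in> S y A})"
  using assms(1,2,4)
proof (induct rule: finite_induct)
  case empty
  \<comment> \<open>For empty \<open>Y\<close> the set is \<open>{0}\<close> only if some choice
    \<open>v\<close> exists at all; the zero choice does.\<close>
  have "\<exists>v. \<forall>y\<in>X. v y \<in> S y A" if "A \<in> R" for A
    using vect.subspace_0[OF subspace_family_subspace[OF assms(3) that]] by (intro exI[of _ "\<lambda>_. 0"]) blast
  then show ?case
    by (intro subspace_family.equal[OF subspace_family_zero]) auto
next
  case (insert y Y)
  let ?T = "\<lambda>A. {(\<Sum>y\<in>Y. g y A (v y)) | v. \<forall>y\<in>X. v y \<in> S y A}"
  have y: "y \<in> X" and pm: "poly_map (g y)" using insert(4,5) by simp_all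
  have T: "subspace_family ?T"
    using insert(4,5) by (intro insert(3)) simp_all
  have "subspace_family (\<lambda>A. {u + t | u t. u \<in> g y A ` S y A \<and> t \<in> ?T A})"
    by (rule subspace_family_plus[OF subspace_family_image[OF assms(3)[OF y] pm] T])
  then show ?case
  proof (rule subspace_family.equal)
    fix A
    show "{u + t | u t. u \<in> g y A ` S y A \<and> t \<in> ?T A} =
        {(\<Sum>y\<in>insert y Y. g y A (v y)) | v. \<forall>y\<in>X. v y \<in> S y A}" (is "?L = ?R")
    proof (intro subset_antisym subsetI)
      fix x assume "x \<in> ?L"
      then obtain s v where s: "s \<in> S y A" and v: "\<forall>y\<in>X. v y \<in> S y A"
          and x: "x = g y A s + (\<Sum>y\<in>Y. g y A (v y))" by blast
      have "(\<Sum>z\<in>Y. g z A ((v(y := s)) z)) = (\<Sum>z\<in>Y. g z A (v z))"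
        using insert(2) by (intro sum.cong refl) auto
      then have "x = (\<Sum>z\<in>insert y Y. g z A ((v(y := s)) z))"
        unfolding x sum.insert[OF insert(1,2)] by (simp only: fun_upd_same)
      moreover have "\<forall>z\<in>X. (v(y := s)) z \<in> S z A" using v s by simp
      ultimately show "x \<in> ?R" by blast
    next
      fix x assume "x \<in> ?R"
      then obtain v where v: "\<forall>y\<in>X. v y \<in> S y A" and x: "x = (\<Sum>y\<in>insert y Y. g y A (v y))"
        by blast
      have "x = g y A (v y) + (\<Sum>y\<in>Y. g y A (v y))"
        unfolding x by (rule sum.insert[OF insert(1,2)])
      then show "x \<in> ?L" using v y by blast
    qed
  qed
qed

lemma rep_family_pullback:
  assumes f: "quiver_hom Q' Q f" and \<Phi>: "rep_family Q \<Phi>"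
  shows "rep_family Q' (\<lambda>A. pullback f (\<Phi> A))"
  unfolding rep_family_def
proof (intro conjI ballI)
  show "pullback f (\<Phi> A) \<in> rep Q'" if "A \<in> R" for A
    by (rule pullback_in_rep[OF f rep_familyD(1)[OF \<Phi> that]])
  show "subspace_family (\<lambda>A. vsp (pullback f (\<Phi> A)) x)" if "x \<in> verts Q'" for x
    using rep_familyD(2)[OF \<Phi>, of "fst f x"] f that by (simp add: pullback_def quiver_hom_def)
  show "poly_map (\<lambda>A. amap (pullback f (\<Phi> A)) a)" if "a \<in> arcs Q'" for a
    using rep_familyD(3)[OF \<Phi>, of "snd f a"] f that by (simp add: pullback_def quiver_hom_def)
qed

lemma rep_family_pushforward:
  assumes Q: "quiver Q" and Q': "quiver Q'" and f: "quiver_hom Q Q' f" and \<Phi>: "rep_family Q \<Phi>"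
  shows "rep_family Q' (\<lambda>A. pushforward Q f (\<Phi> A))"
proof -
  have vsp: "subspace_family (\<lambda>A. vsp (pushforward Q f (\<Phi> A)) x)" for x
    unfolding pushforward_def representation.simps
    using quiverD(1)[OF Q] rep_familyD(2)[OF \<Phi>] poly_map_incl
    by (intro subspace_family_sum) auto
  have amap: "poly_map (\<lambda>A. amap (pushforward Q f (\<Phi> A)) a)" for a
    unfolding pushforward_def representation.simps
    using quiverD(2)[OF Q] rep_familyD(3)[OF \<Phi>]
    by (intro poly_map_sum poly_map_comp[OF poly_map_incl] poly_map_comp[OF _ poly_map_proj]) simp_all
  have "pushforward Q f (\<Phi> A) \<in> rep Q'" if A: "A \<in> R" for A
    unfolding rep_def linear_map_def
  proof (intro CollectI conjI ballI)
    show "fd_subspace (vsp (pushforward Q f (\<Phi> A)) x)" for x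
      by (rule subspace_family_fd[OF vsp A])
    show "Vector_Spaces.linear vscale vscale (amap (pushforward Q f (\<Phi> A)) a)" for a
      by (rule poly_mapD(1)[OF amap A])
    fix a assume a: "a \<in> arcs Q'"
    have \<phi>: "\<Phi> A \<in> rep Q" by (rule rep_familyD(1)[OF \<Phi> A])
    show "amap (pushforward Q f (\<Phi> A)) a ` vsp (pushforward Q f (\<Phi> A)) (tail Q' a)
        \<subseteq> vsp (pushforward Q f (\<Phi> A)) (head Q' a)"
    proof (intro subsetI, elim imageE)
      fix w u assume w: "w = amap (pushforward Q f (\<Phi> A)) a u"
        and u: "u \<in> vsp (pushforward Q f (\<Phi> A)) (tail Q' a)"
      let ?Y = "{y \<in> verts Q. fst f y = tail Q' a}"
      obtain v where v: "\<forall>y\<in>verts Q. v y \<in> vsp (\<Phi> A) y" and uv: "u = (\<Sum>y\<in>?Y. incl Q y (v y))"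
        using u unfolding pushforward_def by auto
      have "incl Q (head Q b) (amap (\<Phi> A) b (proj Q (tail Q b) u))
          \<in> vsp (pushforward Q f (\<Phi> A)) (head Q' a)"
        if b: "b \<in> {b \<in> arcs Q. snd f b = a}" for b
      proof -
        have b': "b \<in> arcs Q" using b by blast
        have fb: "fst f (tail Q b) = tail Q' a" "fst f (head Q b) = head Q' a"
          using f b unfolding quiver_hom_def by auto
        \<comment> \<open>The tail of \<open>b\<close> lies in the fibre over the tail of
          \<open>a\<close>, so its component is among the summands of \<open>u\<close> and the
          projection recovers it.\<close>
        have "proj Q (tail Q b) u = v (tail Q b)"
          unfolding uv using fb(1) quiverD(4)[OF Q b'] by (intro proj_sum_incl[OF Q]) auto
        then have "proj Q (tail Q b) u \<in> vsp (\<Phi> A) (tail Q b)"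
          using v quiverD(4)[OF Q b'] by simp
        then show ?thesis
          by (rule incl_in_vsp_pushforward[OF Q \<phi> quiverD(5)[OF Q b'] fb(2) repD(4)[OF \<phi> b']])
      qed
      then have "(\<Sum>b\<in>{b \<in> arcs Q. snd f b = a}. incl Q (head Q b) (amap (\<Phi> A) b (proj Q (tail Q b) u)))
          \<in> vsp (pushforward Q f (\<Phi> A)) (head Q' a)"
        by (rule vect.subspace_sum[OF subspace_family_subspace[OF vsp A]])
      then show "w \<in> vsp (pushforward Q f (\<Phi> A)) (head Q' a)"
        unfolding w by (simp add: pushforward_def)
    qed
  qed
  then show ?thesis unfolding rep_family_def using vsp amap by blast
qed

lemma rep_family_elementary_functor:
  assumes "quiver Q" "quiver Q'" "elementary_functor Q Q' F" "rep_family Q \<Phi>"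
  shows "rep_family Q' (\<lambda>A. F (\<Phi> A))"
  using assms rep_family_pushforward rep_family_pullback
  unfolding elementary_functor_def by (elim disjE exE conjE) simp_all

section \<open>From the global rank to all rank functions\<close>

text \<open>The family is generalised in the induction: a functor replaces it by another one over
  the same \<open>R\<close>, to which the hypothesis for the rest of the sequence applies.\<close>

lemma constructible_nat_rank_function:
  assumes "nat_rank_function Q r" "rep_family Q \<Phi>"
  shows "constructible_fun (\<lambda>A. r (\<Phi> A))"
  using assms
proof (induct arbitrary: \<Phi> rule: nat_rank_function.induct)
  case (global Q)
  then show ?case by (rule constructible_global_rank)
next
  case (step Q Q' F r)
  show ?case by (rule step(5)[OF rep_family_elementary_functor[OF step(1,2,3,6)]])
qed

lemma constructible_rank_function:
  assumes "rank_function Q r" and \<Phi>: "rep_family Q \<Phi>"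
  shows "constructible_fun (\<lambda>A. r (\<Phi> A))"
proof -
  have Q: "quiver Q" using assms(1) unfolding rank_function_def by blast
  from assms(1) consider "r = global_rank Q"
    | Q' F r' where "quiver Q'" "elementary_functor Q Q' F" "nat_rank_function Q' r'" "r = (\<lambda>\<phi>. r' (F \<phi>))"
    unfolding rank_function_def by blast
  then show ?thesis
  proof cases
    case 1
    then show ?thesis using constructible_global_rank[OF Q \<Phi>] by simp
  next
    case 2
    then show ?thesis
      using constructible_nat_rank_function[OF 2(3) rep_family_elementary_functor[OF Q 2(1,2) \<Phi>]]
      by simp
  qed
qed

lemma constructible_fun_linear_combination:
  fixes cs :: "(real \<times> (('v,'e,'k) representation \<Rightarrow> nat)) list"
  assumes "\<forall>(c, r)\<in>set cs. rank_function Q r" and \<Phi>: "rep_family Q \<Phi>"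
  shows "constructible_fun (\<lambda>A. \<Sum>(c, r)\<leftarrow>cs. c * real (r (\<Phi> A)))"
  using assms(1)
proof (induct cs)
  case Nil
  then show ?case by (simp add: constructible_fun_const)
next
  case (Cons cr cs)
  obtain c r where cr: "cr = (c, r)" by (cases cr)
  have r: "constructible_fun (\<lambda>A. r (\<Phi> A))"
    using Cons(2) by (intro constructible_rank_function[OF _ \<Phi>]) (simp add: cr)
  have "constructible_fun (\<lambda>A. \<Sum>(c, r)\<leftarrow>cs. c * real (r (\<Phi> A)))" using Cons by simp
  with r have "constructible_fun (\<lambda>A. (\<lambda>n s. c * real n + s) (r (\<Phi> A)) (\<Sum>(c, r)\<leftarrow>cs. c * real (r (\<Phi> A))))"
    by (rule constructible_fun_comp2)
  then show ?case by (simp add: cr)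
qed

text \<open>The factor \<open>R\<close> takes care of the empty intersection, which would otherwise
  be the whole type.\<close>

lemma C_finite_INT: "finite \<D> \<Longrightarrow> (\<And>D. D \<in> \<D> \<Longrightarrow> C D) \<Longrightarrow> C (R \<inter> \<Inter>\<D>)"
proof (induct rule: finite_induct)
  case empty
  then show ?case by (simp add: C_UNIV)
next
  case (insert D \<D>)
  have "R \<inter> \<Inter>(insert D \<D>) = D \<inter> (R \<inter> \<Inter>\<D>)" by blast
  then show ?case using insert by (simp add: C_Int)
qed

end

section \<open>The representation space and its tautological family\<close>

text \<open>Members of \<open>poly_funs\<close> are functions on all arguments, while polynomials
  are meant on the representation space. The second parameter is therefore the closure of
  \<open>poly_funs\<close> under agreement on that space, as \<open>P_cong\<close> demands.\<close>

lemma constructible_algebra_zariski: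
  fixes Q :: "('v,'e) pre_digraph"
  shows "constructible_algebra (rep_space Q \<alpha>)
    {f :: ('e \<Rightarrow> 'k::field mat) \<Rightarrow> 'k. \<exists>g\<in>poly_funs Q \<alpha>. \<forall>A\<in>rep_space Q \<alpha>. f A = g A}
    (constructible (zariski Q \<alpha>))"
proof
  let ?R = "rep_space Q \<alpha> :: ('e \<Rightarrow> 'k mat) set"
  let ?P = "{f :: ('e \<Rightarrow> 'k mat) \<Rightarrow> 'k. \<exists>g\<in>poly_funs Q \<alpha>. \<forall>A\<in>?R. f A = g A}"
  show "(\<lambda>_. c) \<in> ?P" for c by (auto intro: poly_funs.const)
  fix p q assume p: "p \<in> ?P"
  obtain p' where p': "p' \<in> poly_funs Q \<alpha>" "\<forall>A\<in>?R. p A = p' A" using p by blast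
  show "q \<in> ?P" if "\<And>A. A \<in> ?R \<Longrightarrow> p A = q A" using p' that by auto
  have "{A \<in> ?R. p A = 0} = zero_locus Q \<alpha> {p'}" unfolding zero_locus_def using p'(2) by auto
  then have "closedin (zariski Q \<alpha>) {A \<in> ?R. p A = 0}" unfolding closedin_zariski using p'(1) by auto
  then show "constructible (zariski Q \<alpha>) {A \<in> ?R. p A = 0}" by (rule constructible.closedin)
  assume "q \<in> ?P"
  then obtain q' where q': "q' \<in> poly_funs Q \<alpha>" "\<forall>A\<in>?R. q A = q' A" by blast
  show "(\<lambda>A. p A + q A) \<in> ?P"
    using poly_funs.add[OF p'(1) q'(1)] p'(2) q'(2) by (intro CollectI bexI) simp_all
  show "(\<lambda>A. p A * q A) \<in> ?P"
    using poly_funs.mult[OF p'(1) q'(1)] p'(2) q'(2) by (intro CollectI bexI) simp_all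
next
  fix D E :: "('e \<Rightarrow> 'k mat) set"
  assume D: "constructible (zariski Q \<alpha>) D"
  show "constructible (zariski Q \<alpha>) (rep_space Q \<alpha> - D)"
    using constructible_compl[OF D] by (simp only: topspace_zariski)
  show "D \<subseteq> rep_space Q \<alpha>"
    using constructible_subset[OF D] by (simp only: topspace_zariski)
  assume "constructible (zariski Q \<alpha>) E"
  with D show "constructible (zariski Q \<alpha>) (D \<inter> E)" by (rule constructible.Int)
qed

lemma amap_rep_of:
  assumes "A \<in> rep_space Q \<alpha>" "a \<in> arcs Q"
  shows "amap (rep_of \<alpha> A) a v i =
    (if i < \<alpha> (head Q a) then \<Sum>j<\<alpha> (tail Q a). A a $$ (i, j) * v j else 0)"
proof -
  have "A a \<in> carrier_mat (\<alpha> (head Q a)) (\<alpha> (tail Q a))"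
    using assms unfolding rep_space_def by blast
  then show ?thesis
    by (auto simp: rep_of_def scalar_prod_def lessThan_atLeast0 intro!: sum.cong)
qed

text \<open>Each point parametrises its own representation. The spaces do not vary and are spanned
  by constant unit vectors; the coordinates of an image vector are bilinear in the matrix entries
  and the vector, hence polynomial.\<close>

lemma rep_family_rep_of:
  fixes Q :: "('v,'e) pre_digraph"
  shows "constructible_algebra.rep_family (rep_space Q \<alpha>)
    {f :: ('e \<Rightarrow> 'k::field mat) \<Rightarrow> 'k. \<exists>g\<in>poly_funs Q \<alpha>. \<forall>A\<in>rep_space Q \<alpha>. f A = g A}
    (constructible (zariski Q \<alpha>)) Q (rep_of \<alpha>)"
proof -
  let ?R = "rep_space Q \<alpha> :: ('e \<Rightarrow> 'k mat) set"
  let ?P = "{f :: ('e \<Rightarrow> 'k mat) \<Rightarrow> 'k. \<exists>g\<in>poly_funs Q \<alpha>. \<forall>A\<in>?R. f A = g A}"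
  interpret constructible_algebra ?R ?P "constructible (zariski Q \<alpha>)"
    by (rule constructible_algebra_zariski)
  have lin: "Vector_Spaces.linear vscale vscale (amap (rep_of \<alpha> A) a)"
    if "A \<in> ?R" "a \<in> arcs Q" for A a
    by (rule vect_linearI; rule ext)
      (simp_all add: amap_rep_of[OF that] vscale_def sum.distrib sum_distrib_left algebra_simps)
  have vsp: "subspace_family (\<lambda>A. vsp (rep_of \<alpha> A) x)" for x
  proof -
    let ?W = "(\<lambda>i A. unit_vect i) ` {..<\<alpha> x} :: (('e \<Rightarrow> 'k mat) \<Rightarrow> 'k vect) set"
    have "poly_vec (\<lambda>A. unit_vect i)" for i
      by (rule poly_vec_const[of "Suc i"]) (simp add: unit_vect_def)
    then have "subspace_family (\<lambda>A. vect.span ((\<lambda>w. w A) ` ?W))"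
      by (intro subspace_family.span) auto
    then show ?thesis
      by (simp add: rep_of_def supported_eq_span_unit_vect image_image)
  qed
  have amap: "poly_map (\<lambda>A. amap (rep_of \<alpha> A) a)" if a: "a \<in> arcs Q" for a
    unfolding poly_map_def
  proof (intro conjI ballI allI impI)
    show "Vector_Spaces.linear vscale vscale (amap (rep_of \<alpha> A) a)" if "A \<in> ?R" for A
      by (rule lin[OF that a])
    fix w assume w: "poly_vec w"
    have "(\<lambda>A. amap (rep_of \<alpha> A) a (w A) i) \<in> ?P" for i
    proof -
      have coord: "(\<lambda>A. A a $$ (i, j)) \<in> ?P" if "i < \<alpha> (head Q a)" "j < \<alpha> (tail Q a)" for j
        by (intro CollectI bexI[OF _ poly_funs.coord[where \<alpha> = \<alpha>, OF a that]] ballI refl)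
      have "(\<lambda>A. if i < \<alpha> (head Q a) then \<Sum>j<\<alpha> (tail Q a). A a $$ (i, j) * w A j else 0) \<in> ?P"
      proof (cases "i < \<alpha> (head Q a)")
        case True
        have "(\<lambda>A. \<Sum>j<\<alpha> (tail Q a). A a $$ (i, j) * w A j) \<in> ?P"
        proof (rule P_sum)
          fix j assume "j \<in> {..<\<alpha> (tail Q a)}"
          then show "(\<lambda>A. A a $$ (i, j) * w A j) \<in> ?P"
            by (intro P_mult[OF coord[OF True] poly_vec_coord[OF w]]) simp
        qed simp
        then show ?thesis by (simp only: True if_True)
      next
        case False
        then show ?thesis using P_const[of 0] by (simp only: if_False)
      qed
      then show ?thesis by (rule P_cong) (simp add: amap_rep_of[OF _ a])
    qed
    moreover have "\<forall>A\<in>?R. \<forall>i\<ge>\<alpha> (head Q a). amap (rep_of \<alpha> A) a (w A) i = 0"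
      by (simp add: amap_rep_of[OF _ a])
    ultimately show "poly_vec (\<lambda>A. amap (rep_of \<alpha> A) a (w A))" unfolding poly_vec_def by blast
  qed
  have "rep_of \<alpha> A \<in> rep Q" if A: "A \<in> ?R" for A
    unfolding rep_def linear_map_def
  proof (intro CollectI conjI ballI)
    show "fd_subspace (vsp (rep_of \<alpha> A) x)" for x
      by (rule subspace_family_fd[OF vsp A])
    fix a assume a: "a \<in> arcs Q"
    show "Vector_Spaces.linear vscale vscale (amap (rep_of \<alpha> A) a)" by (rule lin[OF A a])
    show "amap (rep_of \<alpha> A) a ` vsp (rep_of \<alpha> A) (tail Q a) \<subseteq> vsp (rep_of \<alpha> A) (head Q a)"
      using amap_rep_of[OF A a] by (auto simp: rep_of_def)
  qed
  then show ?thesis unfolding rep_family_def using vsp amap by blast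
qed

theorem theorem15:
  fixes Q :: "('v,'e) pre_digraph" and \<alpha> :: "'v \<Rightarrow> nat"
  assumes "quiver Q"
  shows "(\<forall>n. constructible (zariski Q \<alpha>)
            {A \<in> rep_space Q \<alpha> :: ('e \<Rightarrow> 'k::field mat) set. global_rank Q (rep_of \<alpha> A) = n}) \<and>
         (\<forall>R :: ('e \<Rightarrow> 'k mat) set. rank_locus Q \<alpha> R \<longrightarrow> constructible (zariski Q \<alpha>) R)"
proof (intro conjI allI impI)
  interpret constructible_algebra "rep_space Q \<alpha>"
    "{f :: ('e \<Rightarrow> 'k mat) \<Rightarrow> 'k. \<exists>g\<in>poly_funs Q \<alpha>. \<forall>A\<in>rep_space Q \<alpha>. f A = g A}"
    "constructible (zariski Q \<alpha>)"
    by (rule constructible_algebra_zariski)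
  have \<Phi>: "rep_family Q (rep_of \<alpha>)" by (rule rep_family_rep_of)
  show "constructible (zariski Q \<alpha>)
      {A \<in> rep_space Q \<alpha> :: ('e \<Rightarrow> 'k mat) set. global_rank Q (rep_of \<alpha> A) = n}" for n
    using constructible_global_rank[OF assms \<Phi>] unfolding constructible_fun_def by blast
  have "constructible (zariski Q \<alpha>) S" if lr: "linear_rank_locus Q \<alpha> S" for S :: "('e \<Rightarrow> 'k mat) set"
  proof -
    obtain cs :: "(real \<times> (('v,'e,'k) representation \<Rightarrow> nat)) list" and b
      where cs: "\<forall>(c, r)\<in>set cs. rank_function Q r"
        and S: "S = {A \<in> rep_space Q \<alpha>. (\<Sum>(c, r)\<leftarrow>cs. c * real (r (rep_of \<alpha> A))) \<le> b} \<or>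
          S = {A \<in> rep_space Q \<alpha>. (\<Sum>(c, r)\<leftarrow>cs. c * real (r (rep_of \<alpha> A))) < b}"
      using lr unfolding linear_rank_locus_def by (elim exE conjE) (rule that)
    \<comment> \<open>The combination takes finitely many real values, so every condition on it,
      strict or not, defines a constructible set.\<close>
    note comb = constructible_fun_linear_combination[OF cs \<Phi>]
    show ?thesis
      using S constructible_fun_pred[OF comb, of "\<lambda>s. s \<le> b"] constructible_fun_pred[OF comb, of "\<lambda>s. s < b"]
      by (elim disjE) simp_all
  qed
  note linear = this
  show "constructible (zariski Q \<alpha>) R" if R: "rank_locus Q \<alpha> R" for R :: "('e \<Rightarrow> 'k mat) set"
  proof -
    obtain Ss where Ss: "finite Ss" "\<forall>S\<in>Ss. linear_rank_locus Q \<alpha> S" "R = rep_space Q \<alpha> \<inter> \<Inter>Ss"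
      using R unfolding rank_locus_def by (elim exE conjE) (rule that)
    show ?thesis
      unfolding Ss(3) by (rule C_finite_INT[OF Ss(1) linear[OF Ss(2)[rule_format]]])
  qed
qed

end
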